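(* Let $q\in\{0,\dots,n-1\}$ and let $\omega$ be an open set in $\mathbb{R}^n$. The following are equivalent: (i) $\omega$ is a real $q$-convex set in $\mathbb{R}^n$; (ii) the set $\omega+i(-a,a)^n$ is $q$-pseudoconvex in $\mathbb{C}^n$ for some $a\in(0,+\infty]$; (iii) the set $\omega+i(-a,a)^n$ is $q$-pseudoconvex in $\mathbb{C}^n$ for every $a\in(0,+\infty]$.
   Context: $(-a,a)^n$ with $a=+\infty$ means $\mathbb{R}^n$. $d_2(x,\partial\omega)=\inf\{\|x-y\|_2:y\in\partial\omega\}$ is the Euclidean boundary distance, set to $+\infty$ if $\partial\omega=\emptyset$ (and $-\ln(+\infty)=-\infty$); similarly $d_2(z,\partial\Omega)$ in $\mathbb{C}^n$. Real $q$-convex functions: let $\omega\subset\mathbb{R}^n$ be open and $q\in\{0,\dots,n-1\}$. An upper semi-continuous function $u:\omega\to[-\infty,+\infty)$ is real $q$-convex on $\omega$ if for every real $(q+1)$-dimensional affine subspace $\pi$ of $\mathbb{R}^n$, every open Euclidean ball $B$ relatively compact in $\omega$ and every affine linear function $l:\pi\to\mathbb{R}$ with $u\le l$ on $\partial B\cap\pi$, one has $u\le l$ on $\overline{B}\cap\pi$. An open set $\omega\subset\mathbb{R}^n$ is a real $q$-convex set if $x\mapsto-\ln d_2(x,\partial\omega)$ is real $q$-convex on $\omega$. $q$-plurisubharmonic functions: let $\Omega\subset\mathbb{C}^n$ be open and $q\in\{0,\dots,n-1\}$. An upper semi-continuous function $\psi:\Omega\to[-\infty,+\infty)$ is $q$-plurisubharmonic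 on $\Omega$ if for every complex $(q+1)$-dimensional affine subspace $\Pi$ of $\mathbb{C}^n$, every open Euclidean ball $B$ relatively compact in $\Omega$ and every pluriharmonic function $h$ defined in a neighborhood of $\overline{B}$ with $\psi\le h$ on $\partial B\cap\Pi$, one has $\psi\le h$ on $\overline{B}\cap\Pi$. An open set $\Omega\subset\mathbb{C}^n$ is $q$-pseudoconvex if $z\mapsto-\ln d_2(z,\partial\Omega)$ is $q$-plurisubharmonic on $\Omega$. *)

theory Defs
  imports "HOL-Analysis.Analysis"
begin

definition usc_on :: "'a::topological_space set \<Rightarrow> ('a \<Rightarrow> ereal) \<Rightarrow> bool" where
  "usc_on S u \<longleftrightarrow> (\<forall>x\<in>S. \<forall>c. u x < c \<longrightarrow> (\<forall>\<^sub>F y in at x within S. u y < c))"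

(* The infimum of the empty set of extended reals is \<infinity>, so this is \<infinity> if the frontier is empty. *)
definition bdry_dist :: "'a::metric_space set \<Rightarrow> 'a \<Rightarrow> ereal" where
  "bdry_dist S x = (INF y\<in>frontier S. ereal (dist x y))"

(* Only meant for arguments in (0, \<infinity>]; a point of an open set has positive boundary distance. *)
definition neg_ln :: "ereal \<Rightarrow> ereal" where
  "neg_ln t = (if t = \<infinity> then -\<infinity> else ereal (- ln (real_of_ereal t)))"

definition affine_linear_on :: "'a::real_vector set \<Rightarrow> ('a \<Rightarrow> real) \<Rightarrow> bool" where
  "affine_linear_on P l \<longleftrightarrow>
     (\<forall>x\<in>P. \<forall>y\<in>P. \<forall>t::real. l ((1 - t) *\<^sub>R x + t *\<^sub>R y) = (1 - t) * l x + t * l y)"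

definition real_q_convex_on :: "nat \<Rightarrow> (real^'n::finite) set \<Rightarrow> (real^'n \<Rightarrow> ereal) \<Rightarrow> bool" where
  "real_q_convex_on q \<omega> u \<longleftrightarrow>
     usc_on \<omega> u \<and> (\<forall>x\<in>\<omega>. u x < \<infinity>) \<and>
     (\<forall>P c r l. affine P \<and> aff_dim P = int q + 1 \<and>
        r > 0 \<and> cball c r \<subseteq> \<omega> \<and> affine_linear_on P l \<and>
        (\<forall>x\<in>sphere c r \<inter> P. u x \<le> ereal (l x)) \<longrightarrow>
        (\<forall>x\<in>cball c r \<inter> P. u x \<le> ereal (l x)))"

definition real_q_convex_set :: "nat \<Rightarrow> (real^'n::finite) set \<Rightarrow> bool" where
  "real_q_convex_set q \<omega> \<longleftrightarrow>
     open \<omega> \<and> real_q_convex_on q \<omega> (\<lambda>x. neg_ln (bdry_dist \<omega> x))"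

(* f is twice continuously differentiable on the open set U,
   with first and second derivatives D1 and D2 *)
definition C2_on_with ::
    "'a::real_normed_vector set \<Rightarrow> ('a \<Rightarrow> real) \<Rightarrow>
     ('a \<Rightarrow> ('a \<Rightarrow>\<^sub>L real)) \<Rightarrow> ('a \<Rightarrow> ('a \<Rightarrow>\<^sub>L ('a \<Rightarrow>\<^sub>L real))) \<Rightarrow> bool" where
  "C2_on_with U f D1 D2 \<longleftrightarrow>
     (\<forall>x\<in>U. (f has_derivative blinfun_apply (D1 x)) (at x)) \<and>
     (\<forall>x\<in>U. (D1 has_derivative blinfun_apply (D2 x)) (at x)) \<and>
     continuous_on U D2"

definition harmonic_on :: "complex set \<Rightarrow> (complex \<Rightarrow> real) \<Rightarrow> bool" where
  "harmonic_on U f \<longleftrightarrow>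
     (\<exists>D1 D2. C2_on_with U f D1 D2 \<and>
        (\<forall>z\<in>U. blinfun_apply (blinfun_apply (D2 z) 1) 1
              + blinfun_apply (blinfun_apply (D2 z) \<i>) \<i> = 0))"

definition pluriharmonic_on :: "(complex^'n::finite) set \<Rightarrow> (complex^'n \<Rightarrow> real) \<Rightarrow> bool" where
  "pluriharmonic_on U h \<longleftrightarrow>
     (\<exists>D1 D2. C2_on_with U h D1 D2) \<and>
     (\<forall>a b. harmonic_on {\<zeta>. a + \<zeta> *s b \<in> U} (\<lambda>\<zeta>. h (a + \<zeta> *s b)))"

definition complex_affine_subspace :: "nat \<Rightarrow> (complex^'n::finite) set \<Rightarrow> bool" where
  "complex_affine_subspace k P \<longleftrightarrow>
     (\<exists>p V. vec.subspace V \<and> vec.dim V = k \<and> P = (\<lambda>v. p + v) ` V)"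

definition q_plurisubharmonic_on ::
    "nat \<Rightarrow> (complex^'n::finite) set \<Rightarrow> (complex^'n \<Rightarrow> ereal) \<Rightarrow> bool" where
  "q_plurisubharmonic_on q \<Omega> \<psi> \<longleftrightarrow>
     usc_on \<Omega> \<psi> \<and> (\<forall>z\<in>\<Omega>. \<psi> z < \<infinity>) \<and>
     (\<forall>P c r U h. complex_affine_subspace (q + 1) P \<and>
        r > 0 \<and> cball c r \<subseteq> \<Omega> \<and>
        open U \<and> cball c r \<subseteq> U \<and> pluriharmonic_on U h \<and>
        (\<forall>z\<in>sphere c r \<inter> P. \<psi> z \<le> ereal (h z)) \<longrightarrow>
        (\<forall>z\<in>cball c r \<inter> P. \<psi> z \<le> ereal (h z)))"

definition q_pseudoconvex :: "nat \<Rightarrow> (complex^'n::finite) set \<Rightarrow> bool" where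
  "q_pseudoconvex q \<Omega> \<longleftrightarrow>
     open \<Omega> \<and> q_plurisubharmonic_on q \<Omega> (\<lambda>z. neg_ln (bdry_dist \<Omega> z))"

(* the set \<omega> + i (-a,a)^n *)
definition tube :: "(real^'n::finite) set \<Rightarrow> ereal \<Rightarrow> (complex^'n) set" where
  "tube \<omega> a =
     {(\<chi> k. Complex (x $ k) (y $ k)) | x y. x \<in> \<omega> \<and> (\<forall>k. - a < ereal (y $ k) \<and> ereal (y $ k) < a)}"

end

theory Submission
  imports Defs
begin

text \<open>
  Both implications go through touching points. If the maximum principle fails for a function u, then
  after adding a small multiple of the squared norm the difference to the majorant has an interior
  maximum, where u is touched from above by a strictly concave quadratic polynomial on a suitable plane.

  If the majorant is pluriharmonic, its real Hessian H (after the perturbation) satisfies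
  \<open>H(v,v) + H(iv,iv) < 0\<close> on a complex (q+1)-dimensional space, hence is negative definite on a real
  (q+1)-dimensional subspace. As the boundary distance of \<open>\<omega> + i\<real>\<^sup>n\<close> does not depend
  on the imaginary part, the real part is injective on this subspace, which yields a real touching point
  and contradicts real q-convexity. The width of a finite tube contributes only convex functions.

  Conversely, a real touching point can be slid towards a nearest boundary point until the tube is wider
  than the boundary distance there; the touching polynomial is then complexified, replacing
  \<open>\<bar>x\<bar>\<^sup>2\<close> by the pluriharmonic \<open>\<bar>x\<bar>\<^sup>2 - \<bar>y\<bar>\<^sup>2\<close>.
\<close>

section \<open>The boundary distance\<close>

text \<open>A ball is connected, so if it meets S without lying inside S it meets the frontier;
  conversely an open S is disjoint from its frontier. With an empty frontier both sides are
  true.\<close>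

lemma le_bdry_dist_iff:
  fixes S :: "'a::real_normed_vector set"
  assumes "open S" "x \<in> S" "0 < r"
  shows "ereal r \<le> bdry_dist S x \<longleftrightarrow> ball x r \<subseteq> S"
proof -
  have "ball x r \<subseteq> S \<longleftrightarrow> ball x r \<inter> frontier S = {}"
  proof
    assume "ball x r \<subseteq> S"
    then show "ball x r \<inter> frontier S = {}"
      using assms(1) frontier_disjoint_eq by blast
  next
    assume *: "ball x r \<inter> frontier S = {}"
    have "ball x r \<inter> S \<noteq> {}"
      using assms centre_in_ball by blast
    then have "ball x r - S = {}"
      using * connected_Int_frontier[OF connected_ball] by metis
    then show "ball x r \<subseteq> S" by blast
  qed
  then show ?thesis
    unfolding bdry_dist_def by (auto simp: le_INF_iff disjoint_iff not_less)
qed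

lemma bdry_dist_pos:
  fixes S :: "'a::real_normed_vector set"
  assumes "open S" "x \<in> S"
  shows "0 < bdry_dist S x"
proof -
  obtain r where r: "r > 0" "ball x r \<subseteq> S"
    using assms by (meson open_contains_ball)
  then have "ereal r \<le> bdry_dist S x"
    using le_bdry_dist_iff assms by blast
  with r(1) show ?thesis
    by (metis ereal_less(2) less_le_trans)
qed

lemma neg_ln_le_iff:
  assumes "0 < t"
  shows "neg_ln t \<le> ereal b \<longleftrightarrow> ereal (exp (- b)) \<le> t"
proof (cases t)
  case (real s)
  then have "0 < s" using assms by simp
  then have "- ln s \<le> b \<longleftrightarrow> exp (- b) \<le> s"
    by (metis exp_le_cancel_iff exp_ln minus_le_iff)
  then show ?thesis using real by (simp add: neg_ln_def)
qed (use assms in \<open>auto simp: neg_ln_def\<close>)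

lemma neg_ln_bdry_dist_le_iff:
  fixes S :: "'a::real_normed_vector set"
  assumes "open S" "x \<in> S"
  shows "neg_ln (bdry_dist S x) \<le> ereal b \<longleftrightarrow> ball x (exp (- b)) \<subseteq> S"
  using neg_ln_le_iff[OF bdry_dist_pos[OF assms]] le_bdry_dist_iff[OF assms] by simp

lemma bdry_dist_eq_infdist:
  fixes S :: "'a::euclidean_space set"
  assumes "frontier S \<noteq> {}"
  shows "bdry_dist S x = ereal (infdist x (frontier S))"
proof -
  obtain y where y: "y \<in> frontier S" "infdist x (frontier S) = dist x y"
    using infdist_attains_inf[OF frontier_closed assms] by blast
  have "bdry_dist S x \<le> ereal (dist x y)"
    unfolding bdry_dist_def using y(1) by (rule INF_lower)
  moreover have "ereal (infdist x (frontier S)) \<le> bdry_dist S x"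
    unfolding bdry_dist_def by (rule INF_greatest) (simp add: infdist_le)
  ultimately show ?thesis using y(2) by simp
qed

lemma infdist_frontier_pos:
  fixes S :: "'a::euclidean_space set"
  assumes "open S" "x \<in> S" "frontier S \<noteq> {}"
  shows "0 < infdist x (frontier S)"
  using bdry_dist_pos[OF assms(1,2)] bdry_dist_eq_infdist[OF assms(3)] by simp

text \<open>The touching arguments compare and maximise the logarithm, so they need a continuous
  real-valued function. An empty frontier is treated separately where it arises.\<close>

lemma ball_exp_subset_iff:
  fixes S :: "'a::euclidean_space set"
  assumes "open S" "x \<in> S" "frontier S \<noteq> {}"
  shows "ball x (exp (- b)) \<subseteq> S \<longleftrightarrow> - ln (infdist x (frontier S)) \<le> b"
proof -
  have "bdry_dist S x = ereal (infdist x (frontier S))"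
    by (rule bdry_dist_eq_infdist[OF assms(3)])
  then show ?thesis
    using neg_ln_bdry_dist_le_iff[OF assms(1,2), of b] by (simp add: neg_ln_def)
qed

lemma continuous_on_neg_ln_infdist:
  fixes S :: "'a::euclidean_space set"
  assumes "open S" "frontier S \<noteq> {}"
  shows "continuous_on S (\<lambda>x. - ln (infdist x (frontier S)))"
  by (intro continuous_intros) (use infdist_frontier_pos[OF assms(1) _ assms(2)] in force)

lemma usc_on_neg_ln_bdry_dist:
  fixes S :: "'a::euclidean_space set"
  assumes "open S"
  shows "usc_on S (\<lambda>x. neg_ln (bdry_dist S x))"
proof (cases "frontier S = {}")
  case True
  then show ?thesis
    by (simp add: usc_on_def bdry_dist_def)
next
  case False
  have eq: "neg_ln (bdry_dist S x) = ereal (- ln (infdist x (frontier S)))" for x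
    using False by (simp add: bdry_dist_eq_infdist neg_ln_def)
  have "continuous_on S (\<lambda>x. neg_ln (bdry_dist S x))"
    unfolding eq by (intro continuous_intros continuous_on_neg_ln_infdist assms False)
  then show ?thesis
    unfolding usc_on_def continuous_on_def using order_tendstoD(2) by fast
qed

lemma neg_ln_less_PInf: "neg_ln t < \<infinity>"
  by (simp add: neg_ln_def)

section \<open>The maximum principle as a statement about inclusions of balls\<close>

lemma neg_ln_bdry_dist_maximum_principle_iff:
  fixes S :: "'a::euclidean_space set"
  assumes "open S"
  shows "(cball c r \<subseteq> S \<longrightarrow>
       (\<forall>x\<in>sphere c r \<inter> P. neg_ln (bdry_dist S x) \<le> ereal (l x)) \<longrightarrow>
       (\<forall>x\<in>cball c r \<inter> P. neg_ln (bdry_dist S x) \<le> ereal (l x))) \<longleftrightarrow>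
    (cball c r \<subseteq> S \<longrightarrow>
       (\<forall>x\<in>sphere c r \<inter> P. ball x (exp (- l x)) \<subseteq> S) \<longrightarrow>
       (\<forall>x\<in>cball c r \<inter> P. ball x (exp (- l x)) \<subseteq> S))"
proof -
  have *: "(\<forall>x\<in>K \<inter> P. neg_ln (bdry_dist S x) \<le> ereal (l x)) \<longleftrightarrow>
        (\<forall>x\<in>K \<inter> P. ball x (exp (- l x)) \<subseteq> S)" if "K \<subseteq> S" for K
    using neg_ln_bdry_dist_le_iff[OF assms subsetD[OF that]] by (metis IntD1)
  show ?thesis
  proof (cases "cball c r \<subseteq> S")
    case True
    then have "sphere c r \<subseteq> S" using sphere_cball by blast
    then show ?thesis by (simp only: *[OF True] *)
  qed simp
qed

text \<open>Upper semicontinuity and the bound by \<infinity> hold for every open set, so only the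
  maximum principle remains. Radii \<open>exp (- l x)\<close> take the place of extended real
  values.\<close>

lemma real_q_convex_set_iff:
  fixes \<omega> :: "(real^'n::finite) set"
  assumes "open \<omega>"
  shows "real_q_convex_set q \<omega> \<longleftrightarrow>
    (\<forall>P c r l. affine P \<longrightarrow> aff_dim P = int q + 1 \<longrightarrow> r > 0 \<longrightarrow> affine_linear_on P l \<longrightarrow>
       cball c r \<subseteq> \<omega> \<longrightarrow> (\<forall>x\<in>sphere c r \<inter> P. ball x (exp (- l x)) \<subseteq> \<omega>) \<longrightarrow>
       (\<forall>x\<in>cball c r \<inter> P. ball x (exp (- l x)) \<subseteq> \<omega>))"
proof -
  have "real_q_convex_set q \<omega> \<longleftrightarrow>
    (\<forall>P c r l. affine P \<longrightarrow> aff_dim P = int q + 1 \<longrightarrow> r > 0 \<longrightarrow> affine_linear_on P l \<longrightarrow>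
       cball c r \<subseteq> \<omega> \<longrightarrow>
       (\<forall>x\<in>sphere c r \<inter> P. neg_ln (bdry_dist \<omega> x) \<le> ereal (l x)) \<longrightarrow>
       (\<forall>x\<in>cball c r \<inter> P. neg_ln (bdry_dist \<omega> x) \<le> ereal (l x)))"
    unfolding real_q_convex_set_def real_q_convex_on_def
    using assms usc_on_neg_ln_bdry_dist[OF assms] neg_ln_less_PInf by blast
  then show ?thesis
    unfolding neg_ln_bdry_dist_maximum_principle_iff[OF assms] .
qed

lemma q_pseudoconvex_iff:
  fixes \<Omega> :: "(complex^'n::finite) set"
  assumes "open \<Omega>"
  shows "q_pseudoconvex q \<Omega> \<longleftrightarrow>
    (\<forall>P c r U h. complex_affine_subspace (q + 1) P \<longrightarrow> r > 0 \<longrightarrow>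
       open U \<longrightarrow> cball c r \<subseteq> U \<longrightarrow> pluriharmonic_on U h \<longrightarrow>
       cball c r \<subseteq> \<Omega> \<longrightarrow> (\<forall>z\<in>sphere c r \<inter> P. ball z (exp (- h z)) \<subseteq> \<Omega>) \<longrightarrow>
       (\<forall>z\<in>cball c r \<inter> P. ball z (exp (- h z)) \<subseteq> \<Omega>))"
proof -
  have "q_pseudoconvex q \<Omega> \<longleftrightarrow>
    (\<forall>P c r U h. complex_affine_subspace (q + 1) P \<longrightarrow> r > 0 \<longrightarrow>
       open U \<longrightarrow> cball c r \<subseteq> U \<longrightarrow> pluriharmonic_on U h \<longrightarrow>
       cball c r \<subseteq> \<Omega> \<longrightarrow>
       (\<forall>z\<in>sphere c r \<inter> P. neg_ln (bdry_dist \<Omega> z) \<le> ereal (h z)) \<longrightarrow>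
       (\<forall>z\<in>cball c r \<inter> P. neg_ln (bdry_dist \<Omega> z) \<le> ereal (h z)))"
    unfolding q_pseudoconvex_def q_plurisubharmonic_on_def
    using assms usc_on_neg_ln_bdry_dist[OF assms] neg_ln_less_PInf by blast
  then show ?thesis
    unfolding neg_ln_bdry_dist_maximum_principle_iff[OF assms] .
qed

section \<open>Tubes\<close>

definition vec_Re :: "complex^'n::finite \<Rightarrow> real^'n" where
  "vec_Re z = (\<chi> k. Re (z $ k))"

definition vec_Im :: "complex^'n::finite \<Rightarrow> real^'n" where
  "vec_Im z = (\<chi> k. Im (z $ k))"

definition vec_of_real :: "real^'n::finite \<Rightarrow> complex^'n" where
  "vec_of_real x = (\<chi> k. complex_of_real (x $ k))"

lemma linear_vec_Re: "linear vec_Re"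
  by (intro linearI) (auto simp: vec_Re_def vec_eq_iff)

lemma linear_vec_Im: "linear vec_Im"
  by (intro linearI) (auto simp: vec_Im_def vec_eq_iff)

lemma vec_Re_of_real [simp]: "vec_Re (vec_of_real x) = x"
  by (simp add: vec_Re_def vec_of_real_def vec_eq_iff)

lemma vec_Im_of_real [simp]: "vec_Im (vec_of_real x) = 0"
  by (simp add: vec_Im_def vec_of_real_def vec_eq_iff)

lemma norm_vec_Re_Im: "(norm z)\<^sup>2 = (norm (vec_Re z))\<^sup>2 + (norm (vec_Im z))\<^sup>2"
  by (simp add: power2_norm_eq_inner inner_vec_def inner_complex_def vec_Re_def vec_Im_def
      sum.distrib)

lemma norm_vec_Re_le: "norm (vec_Re z) \<le> norm z"
  by (rule power2_le_imp_le) (simp_all add: norm_vec_Re_Im[of z])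

lemma mem_tube_iff: "z \<in> tube \<omega> a \<longleftrightarrow> vec_Re z \<in> \<omega> \<and> (\<forall>k. ereal \<bar>Im (z $ k)\<bar> < a)"
proof -
  have *: "- a < ereal t \<and> ereal t < a \<longleftrightarrow> ereal \<bar>t\<bar> < a" for t
    by (cases a) auto
  have "z \<in> tube \<omega> a \<longleftrightarrow> vec_Re z \<in> \<omega> \<and> (\<forall>k. - a < ereal (vec_Im z $ k) \<and> ereal (vec_Im z $ k) < a)"
    (is "?l \<longleftrightarrow> ?r")
  proof
    assume ?l
    then obtain x y where z: "z = (\<chi> k. Complex (x $ k) (y $ k))" and "x \<in> \<omega>"
      and "\<forall>k. - a < ereal (y $ k) \<and> ereal (y $ k) < a"
      unfolding tube_def by blast
    moreover have "vec_Re z = x" "vec_Im z = y"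
      unfolding z vec_Re_def vec_Im_def by (auto simp: vec_eq_iff)
    ultimately show ?r by simp
  next
    assume ?r
    moreover have "z = (\<chi> k. Complex (vec_Re z $ k) (vec_Im z $ k))"
      by (simp add: vec_Re_def vec_Im_def vec_eq_iff)
    ultimately show ?l unfolding tube_def by blast
  qed
  then show ?thesis unfolding * by (simp add: vec_Im_def)
qed

text \<open>The boundary distance of a tube is the minimum of the one of \<omega> at the real part
  and of the gaps between \<open>a\<close> and the absolute values of the imaginary coordinates.
  Keeping these constraints apart lets each be treated by its own argument.\<close>

lemma ball_subset_tube_iff:
  assumes "0 < r"
  shows "ball z r \<subseteq> tube \<omega> a \<longleftrightarrow>
    ball (vec_Re z) r \<subseteq> \<omega> \<and> (\<forall>k. ereal (\<bar>Im (z $ k)\<bar> + r) \<le> a)" (is "?l \<longleftrightarrow> ?r")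
proof
  assume l: ?l
  show ?r
  proof
    show "ball (vec_Re z) r \<subseteq> \<omega>"
    proof
      fix x assume x: "x \<in> ball (vec_Re z) r"
      let ?z = "z + vec_of_real (x - vec_Re z)"
      have "norm (vec_of_real (x - vec_Re z)) = norm (x - vec_Re z)"
        using norm_vec_Re_Im[of "vec_of_real (x - vec_Re z)"] by simp
      then have "?z \<in> ball z r"
        using x by (simp add: dist_norm norm_minus_commute)
      then have "vec_Re ?z \<in> \<omega>" using l mem_tube_iff by blast
      then show "x \<in> \<omega>" by (simp add: linear_add[OF linear_vec_Re])
    qed
    show "\<forall>k. ereal (\<bar>Im (z $ k)\<bar> + r) \<le> a"
    proof
      fix k
      have "ereal (\<bar>Im (z $ k)\<bar> + s) < a" if s: "0 \<le> s" "s < r" for s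
      proof -
        \<comment> \<open>The sign makes the shift point away from zero, so that the absolute value
          of the coordinate grows by exactly \<open>s\<close>.\<close>
        define t where "t = (if Im (z $ k) \<ge> 0 then s else - s)"
        let ?z = "z + axis k (\<i> * complex_of_real t)"
        have "\<bar>t\<bar> = s" using s by (simp add: t_def)
        moreover have "norm (axis k c) = norm c" for c :: complex
          by (simp only: norm_eq_sqrt_inner inner_axis_axis) simp
        ultimately have "?z \<in> ball z r"
          using s by (simp add: dist_norm norm_mult)
        then have "ereal \<bar>Im (?z $ k)\<bar> < a" using l mem_tube_iff by blast
        moreover have "\<bar>Im (?z $ k)\<bar> = \<bar>Im (z $ k)\<bar> + s"
          using s by (simp add: axis_def t_def)
        ultimately show ?thesis by simp
      qed
      note * = this
      show "ereal (\<bar>Im (z $ k)\<bar> + r) \<le> a"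
      proof (cases a)
        case (real b)
        \<comment> \<open>The strict bounds for all \<open>s < r\<close> give the non-strict bound
          at \<open>r\<close>: otherwise the shift by the whole gap would be admissible and reach
          the excluded value \<open>b\<close>.\<close>
        have "\<bar>Im (z $ k)\<bar> + r \<le> b"
        proof (rule ccontr)
          assume n: "\<not> ?thesis"
          have "\<bar>Im (z $ k)\<bar> < b" using *[of 0] assms real by simp
          then show False using *[of "b - \<bar>Im (z $ k)\<bar>"] n real by auto
        qed
        then show ?thesis using real by simp
      qed (use *[of 0] assms in auto)
    qed
  qed
next
  assume r: ?r
  show ?l
  proof
    fix w assume w: "w \<in> ball z r"
    have "norm (vec_Re (w - z)) < r"
      using norm_vec_Re_le[of "w - z"] w by (simp add: dist_norm norm_minus_commute)
    then have "vec_Re w \<in> \<omega>"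
      using r by (auto simp: linear_diff[OF linear_vec_Re] dist_norm norm_minus_commute)
    moreover have "ereal \<bar>Im (w $ k)\<bar> < a" for k
    proof -
      have "\<bar>Im ((w - z) $ k)\<bar> \<le> norm (w - z)"
        by (rule order_trans[OF abs_Im_le_cmod Finite_Cartesian_Product.norm_nth_le])
      then have "\<bar>Im (w $ k)\<bar> < \<bar>Im (z $ k)\<bar> + r"
        using w by (simp add: dist_norm norm_minus_commute)
      then show ?thesis using r by (metis ereal_less_eq(3) less_ereal.simps(1) less_le_trans)
    qed
    ultimately show "w \<in> tube \<omega> a" by (simp add: mem_tube_iff)
  qed
qed

lemma open_tube:
  assumes "open \<omega>"
  shows "open (tube \<omega> a)"
proof -
  have "continuous_on UNIV vec_Re"
    by (simp add: linear_continuous_on linear_linear linear_vec_Re)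
  then have "open (vec_Re -` \<omega>)"
    using assms by (metis open_vimage)
  moreover have "open {z. ereal \<bar>Im (z $ k)\<bar> < a}" for k
    by (intro open_Collect_less continuous_intros)
  then have "open (\<Inter>k. {z. ereal \<bar>Im (z $ k)\<bar> < a})"
    by (intro open_INT) auto
  moreover have "tube \<omega> a = vec_Re -` \<omega> \<inter> (\<Inter>k. {z. ereal \<bar>Im (z $ k)\<bar> < a})"
    by (auto simp: mem_tube_iff)
  ultimately show ?thesis by (metis open_Int)
qed

section \<open>Negative subspaces of a quadratic form\<close>

lemma scaleR_eq_of_real_scalar_mult:
  fixes v :: "complex^'n::finite"
  shows "a *\<^sub>R v = complex_of_real a *s v"
  by (simp add: vec_eq_iff complex_eq_iff)

lemma complex_subspace_imp_subspace:
  fixes V :: "(complex^'n::finite) set"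
  assumes "vec.subspace V"
  shows "subspace V"
  unfolding subspace_def scaleR_eq_of_real_scalar_mult
  using assms by (simp add: vec.subspace_def)

text \<open>Each condition lowers the dimension by at most one: if \<open>f j\<close> is nonzero at
  some \<open>u\<close> of the remaining space, subtracting a multiple of \<open>u\<close> moves any
  vector of that space into the kernel.\<close>

lemma dim_le_dim_common_zeros:
  fixes f :: "'i \<Rightarrow> 'a::field^'n::finite \<Rightarrow> 'a"
  assumes "finite I" and V: "vec.subspace V"
    and add: "\<And>i v w. f i (v + w) = f i v + f i w"
    and scale: "\<And>i c v. f i (c *s v) = c * f i v"
  shows "vec.dim V \<le> vec.dim {v \<in> V. \<forall>i\<in>I. f i v = 0} + card I"
  using \<open>finite I\<close>
proof (induction I rule: finite_induct)
  case empty
  then show ?case by simp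
next
  case (insert j I)
  let ?W = "{v \<in> V. \<forall>i\<in>I. f i v = 0}"
  let ?W' = "{v \<in> V. \<forall>i\<in>insert j I. f i v = 0}"
  have diff: "f i (v - w) = f i v - f i w" for i v w
    using add[of i "v - w" w] by simp
  have "vec.dim ?W \<le> vec.dim ?W' + 1"
  proof (cases "\<exists>u\<in>?W. f j u \<noteq> 0")
    case True
    then obtain u where u: "u \<in> ?W" "f j u \<noteq> 0" by blast
    have "?W \<subseteq> vec.span (insert u ?W')"
    proof
      fix v assume v: "v \<in> ?W"
      let ?w = "v - (f j v / f j u) *s u"
      have "?w \<in> ?W'"
        using u v V by (auto simp: diff scale vec.subspace_diff vec.subspace_scale)
      then have "?w + (f j v / f j u) *s u \<in> vec.span (insert u ?W')"
        by (intro vec.span_add vec.span_scale vec.span_base) auto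
      then show "v \<in> vec.span (insert u ?W')" by simp
    qed
    then have "vec.dim ?W \<le> vec.dim (insert u ?W')"
      by (rule vec.dim_mono)
    also have "\<dots> \<le> vec.dim ?W' + 1" by (simp add: vec.dim_insert)
    finally show ?thesis .
  next
    case False
    then have "?W = ?W'" by auto
    then show ?thesis by simp
  qed
  then show ?case using insert by simp
qed

text \<open>Induction on \<open>k\<close>: a real basis of S imposes \<open>k\<close> complex linear
  conditions on V, so a larger complex dimension leaves a nonzero \<open>v\<close> such that
  \<open>v\<close> and \<open>\<i> *s v\<close> are both orthogonal to S with respect to H. One of
  the two enlarges S, and orthogonality removes the mixed terms.\<close>

lemma exists_negative_definite_subspace:
  fixes H :: "complex^'n::finite \<Rightarrow> complex^'n \<Rightarrow> real"
  assumes lin: "\<And>w. linear (\<lambda>v. H v w)" and sym: "\<And>v w. H v w = H w v"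
    and V: "vec.subspace V"
    and neg: "\<And>v. v \<in> V \<Longrightarrow> v \<noteq> 0 \<Longrightarrow> H v v + H (\<i> *s v) (\<i> *s v) < 0"
    and "k \<le> vec.dim V"
  shows "\<exists>S. subspace S \<and> S \<subseteq> V \<and> dim S = k \<and> (\<forall>v\<in>S. v \<noteq> 0 \<longrightarrow> H v v < 0)"
  using \<open>k \<le> vec.dim V\<close>
proof (induction k)
  case 0
  have "subspace {0} \<and> {0} \<subseteq> V \<and> dim {0::complex^'n} = 0"
    using V by (simp add: vec.subspace_0 subspace_single_0)
  then show ?case by blast
next
  case (Suc k)
  then obtain S where S: "subspace S" "S \<subseteq> V" "dim S = k" "\<And>v. v \<in> S \<Longrightarrow> v \<noteq> 0 \<Longrightarrow> H v v < 0"
    by auto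
  obtain B where B: "B \<subseteq> S" "independent B" "S \<subseteq> span B" "card B = k"
    using basis_exists[of S] S(3) by metis
  note Hadd = linear_add[OF lin] and Hscale = linear_scale[OF lin]
  \<comment> \<open>The functional is complex linear, although H is only real bilinear.\<close>
  define f where "f s v = Complex (H v s) (- H (\<i> *s v) s)" for s v
  have "vec.dim V \<le> vec.dim {v \<in> V. \<forall>s\<in>B. f s v = 0} + card B"
  proof (rule dim_le_dim_common_zeros)
    show "finite B" using B(2) by (rule finiteI_independent)
    show "f s (v + w) = f s v + f s w" for s v w
      by (simp add: f_def complex_eq_iff Hadd vec.scale_right_distrib)
    show "f s (c *s v) = c * f s v" for s c v
    proof -
      have 1: "c *s v = Re c *\<^sub>R v + Im c *\<^sub>R (\<i> *s v)"
        by (simp add: vec_eq_iff complex_eq_iff)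
      have 2: "\<i> *s (c *s v) = Re c *\<^sub>R (\<i> *s v) + (- Im c) *\<^sub>R v"
        by (simp add: vec_eq_iff complex_eq_iff)
      show ?thesis
        unfolding f_def 2 unfolding 1 Hadd Hscale by (simp add: complex_eq_iff)
    qed
  qed (rule V)
  then have "vec.dim {v \<in> V. \<forall>s\<in>B. f s v = 0} \<noteq> 0"
    using Suc.prems B(4) by linarith
  then obtain v where v: "v \<in> V" "v \<noteq> 0" "\<And>s. s \<in> B \<Longrightarrow> f s v = 0"
    by (auto simp: vec.dim_eq_0)
  \<comment> \<open>The two values of H have a negative sum, so one of them is negative. The real
    and imaginary parts of \<open>f\<close> give the orthogonality in either case.\<close>
  define w where "w = (if H v v < 0 then v else \<i> *s v)"
  have w: "w \<in> V" "H w w < 0"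
    using neg[OF v(1,2)] v(1) V by (auto simp: w_def vec.subspace_scale)
  have "H s w = 0" if "s \<in> S" for s
  proof (rule linear_eq_0_on_span[OF lin])
    show "s \<in> span B" using that B(3) by blast
    show "H s w = 0" if "s \<in> B" for s
      using v(3)[OF that] sym[of s] by (simp add: f_def w_def complex_eq_iff)
  qed
  then have ws: "H s w = 0" "H w s = 0" if "s \<in> S" for s
    using that sym by auto
  then have "w \<notin> span S"
    using w(2) S(1) by (metis less_irrefl span_eq_iff)
  then have "dim (span (insert w S)) = Suc k"
    using S(3) by (simp add: dim_insert)
  moreover have "span (insert w S) \<subseteq> V"
    using w(1) S(2) V by (intro span_minimal) (auto simp: complex_subspace_imp_subspace)
  moreover have "H x x < 0" if x_span: "x \<in> span (insert w S)" and "x \<noteq> 0" for x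
  proof -
    obtain c where "x - c *\<^sub>R w \<in> span S"
      using x_span span_breakdown_eq by blast
    then have c: "x - c *\<^sub>R w \<in> S"
      using span_eq_iff S(1) by metis
    define s where "s = x - c *\<^sub>R w"
    have x: "x = s + c *\<^sub>R w" and s: "s \<in> S"
      using c by (auto simp: s_def)
    have expand: "H x y = H s y + c * H w y" for y
      unfolding x Hadd Hscale by simp
    have eq: "H x x = H s s + c\<^sup>2 * H w w"
      unfolding expand[of x] sym[of s x] sym[of w x] expand[of s] expand[of w] ws[OF s]
      by (simp add: power2_eq_square)
    show ?thesis
    proof (cases "c = 0")
      case True
      then show ?thesis using S(4)[OF s] \<open>x \<noteq> 0\<close> x by simp
    next
      case False
      have "H 0 0 = 0" using linear_0[OF lin] .
      then have "H s s \<le> 0" using S(4)[OF s] by (cases "s = 0") auto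
      moreover have "c\<^sup>2 * H w w < 0" using False w(2) by (simp add: mult_pos_neg)
      ultimately show ?thesis using eq by linarith
    qed
  qed
  ultimately show ?case
    by (intro exI[of _ "span (insert w S)"] conjI subspace_span ballI impI)
qed

section \<open>Touching points\<close>

text \<open>Taylor's formula with Lagrange remainder along the segment from \<open>x\<close> to
  \<open>x + v\<close>. Continuity of \<open>D2\<close> moves the intermediate point to
  \<open>x\<close> at the cost of the \<eta> term.\<close>

lemma C2_second_order_upper_bound:
  fixes h :: "'a::real_normed_vector \<Rightarrow> real"
  assumes C2: "C2_on_with U h D1 D2" and "open U" "x \<in> U" "0 < \<eta>"
  obtains \<rho> where "\<rho> > 0" "ball x \<rho> \<subseteq> U"
    "\<And>v. norm v < \<rho> \<Longrightarrow> h (x + v) \<le> h x + D1 x v + (D2 x v v + \<eta> * (norm v)\<^sup>2) / 2"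
proof -
  obtain \<rho>1 where \<rho>1: "\<rho>1 > 0" "ball x \<rho>1 \<subseteq> U"
    using assms by (meson open_contains_ball)
  have "continuous (at x) D2"
    using assms by (simp add: C2_on_with_def continuous_on_eq_continuous_at)
  then obtain \<rho>2 where \<rho>2: "\<rho>2 > 0" "\<And>y. dist y x < \<rho>2 \<Longrightarrow> dist (D2 y) (D2 x) < \<eta>"
    using \<open>0 < \<eta>\<close> unfolding continuous_at_eps_delta by blast
  define \<rho> where "\<rho> = min \<rho>1 \<rho>2"
  have \<rho>: "\<rho> > 0" "\<And>y. dist y x < \<rho> \<Longrightarrow> y \<in> U \<and> dist (D2 y) (D2 x) < \<eta>"
    using \<rho>1 \<rho>2 by (auto simp: \<rho>_def dist_commute subset_eq)
  show ?thesis
  proof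
    show "\<rho> > 0" by fact
    show "ball x \<rho> \<subseteq> U" using \<rho>(2) by (auto simp: dist_commute)
    fix v :: 'a assume v: "norm v < \<rho>"
    define diff where "diff m = (if m = 0 then (\<lambda>t. h (x + t *\<^sub>R v)) else
      if m = 1 then (\<lambda>t. D1 (x + t *\<^sub>R v) v) else (\<lambda>t. D2 (x + t *\<^sub>R v) v v))" for m :: nat
    have near: "x + t *\<^sub>R v \<in> U \<and> dist (D2 (x + t *\<^sub>R v)) (D2 x) < \<eta>" if "0 \<le> t" "t \<le> 1" for t
    proof (rule \<rho>(2))
      have "\<bar>t\<bar> * norm v \<le> 1 * norm v" using that by (intro mult_right_mono) auto
      then show "dist (x + t *\<^sub>R v) x < \<rho>" using v by (simp add: dist_norm)
    qed
    have "DERIV (diff m) t :> diff (Suc m) t" if "m < 2" "0 \<le> t" "t \<le> 1" for m t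
    proof -
      have aff: "((\<lambda>t. x + t *\<^sub>R v) has_derivative (\<lambda>s. s *\<^sub>R v)) (at t)"
        by (auto intro!: derivative_eq_intros)
      have U: "x + t *\<^sub>R v \<in> U" using near that by blast
      have D: "(h has_derivative D1 (x + t *\<^sub>R v)) (at (x + t *\<^sub>R v))"
              "(D1 has_derivative D2 (x + t *\<^sub>R v)) (at (x + t *\<^sub>R v))"
        using C2 U by (auto simp: C2_on_with_def)
      consider "m = 0" | "m = 1" using \<open>m < 2\<close> by linarith
      then show ?thesis
      proof cases
        case 1
        have "((\<lambda>t. h (x + t *\<^sub>R v)) has_derivative (\<lambda>s. D1 (x + t *\<^sub>R v) (s *\<^sub>R v))) (at t)"
          using has_derivative_compose[OF aff D(1)] .
        then show ?thesis
          using 1 by (simp add: diff_def has_field_derivative_def blinfun.scaleR_right mult_commute_abs)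
      next
        case 2
        have "((\<lambda>t. D1 (x + t *\<^sub>R v) v) has_derivative (\<lambda>s. D2 (x + t *\<^sub>R v) (s *\<^sub>R v) v)) (at t)"
          using has_derivative_compose[OF aff D(2)] by (auto intro!: derivative_eq_intros)
        then show ?thesis
          using 2 by (simp add: diff_def has_field_derivative_def blinfun.scaleR_right
              blinfun.scaleR_left mult_commute_abs)
      qed
    qed
    then obtain t where t: "0 < t" "t < 1"
      "diff 0 1 = (\<Sum>m<2. (diff m 0 / fact m) * 1 ^ m) + (diff 2 t / fact 2) * 1 ^ 2"
      using Maclaurin[of 1 2 diff "diff 0"] by auto
    have "D2 (x + t *\<^sub>R v) v v - D2 x v v = (D2 (x + t *\<^sub>R v) - D2 x) v v"
      by (simp add: blinfun.diff_left)
    also have "\<dots> \<le> norm ((D2 (x + t *\<^sub>R v) - D2 x) v) * norm v"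
      using norm_blinfun[of "(D2 (x + t *\<^sub>R v) - D2 x) v" v] by simp
    also have "\<dots> \<le> (norm (D2 (x + t *\<^sub>R v) - D2 x) * norm v) * norm v"
      by (intro mult_right_mono norm_blinfun) simp
    also have "\<dots> \<le> (\<eta> * norm v) * norm v"
      using near[of t] t by (intro mult_right_mono) (auto simp: dist_norm)
    finally have "D2 (x + t *\<^sub>R v) v v \<le> D2 x v v + \<eta> * (norm v)\<^sup>2"
      by (simp add: power2_eq_square)
    then show "h (x + v) \<le> h x + D1 x v + (D2 x v v + \<eta> * (norm v)\<^sup>2) / 2"
      using t(3) by (simp add: diff_def numeral_2_eq_2)
  qed
qed

text \<open>The small quadratic term keeps the maximum off the sphere: there the perturbed function
  is at most \<open>\<epsilon> * r\<^sup>2\<close>, which is less than \<open>f y\<close>.\<close>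

lemma obtain_interior_peak:
  fixes f :: "'a::euclidean_space \<Rightarrow> real"
  assumes "continuous_on (cball c r \<inter> P) f" "closed P"
    and bd: "\<And>x. x \<in> sphere c r \<inter> P \<Longrightarrow> f x \<le> 0" and y: "y \<in> cball c r \<inter> P" "0 < f y"
  obtains \<epsilon> x where "\<epsilon> > 0" "x \<in> ball c r \<inter> P"
    "\<And>z. z \<in> cball c r \<inter> P \<Longrightarrow> f z + \<epsilon> * (norm (z - c))\<^sup>2 \<le> f x + \<epsilon> * (norm (x - c))\<^sup>2"
proof -
  \<comment> \<open>This makes \<open>\<epsilon> * r\<^sup>2\<close> at most half of
    \<open>f y\<close>; the summand 1 keeps the denominator positive.\<close>
  define \<epsilon> where "\<epsilon> = f y / (2 * (r\<^sup>2 + 1))"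
  have pos: "0 < r\<^sup>2 + 1" by (simp add: add_nonneg_pos)
  then have \<epsilon>: "\<epsilon> > 0" using y(2) by (simp add: \<epsilon>_def)
  have "\<epsilon> * r\<^sup>2 \<le> \<epsilon> * (r\<^sup>2 + 1)" using \<epsilon> by simp
  also have "\<dots> = f y / 2" using pos by (simp add: \<epsilon>_def field_simps)
  also have "\<dots> < f y" using y(2) by simp
  finally have small: "\<epsilon> * r\<^sup>2 < f y" .
  have "compact (cball c r \<inter> P)" using assms(2) by (simp add: compact_Int_closed)
  moreover have "continuous_on (cball c r \<inter> P) (\<lambda>z. f z + \<epsilon> * (norm (z - c))\<^sup>2)"
    by (intro continuous_intros assms(1))
  ultimately obtain x where x: "x \<in> cball c r \<inter> P"
    "\<And>z. z \<in> cball c r \<inter> P \<Longrightarrow> f z + \<epsilon> * (norm (z - c))\<^sup>2 \<le> f x + \<epsilon> * (norm (x - c))\<^sup>2"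
    using continuous_attains_sup[of "cball c r \<inter> P"] y(1) by blast
  have "x \<notin> sphere c r"
  proof
    assume "x \<in> sphere c r"
    then have "f x \<le> 0" "norm (x - c) = r"
      using bd x(1) by (auto simp: dist_norm norm_minus_commute)
    moreover have "f y \<le> f y + \<epsilon> * (norm (y - c))\<^sup>2" using \<epsilon> by simp
    ultimately show False using x(2)[OF y(1)] small by simp
  qed
  then have "x \<in> ball c r \<inter> P" using x(1) by auto
  then show ?thesis using that \<epsilon> x(2) by blast
qed

text \<open>\<open>affine_linear_on\<close> constrains \<open>l\<close> on P only. The linear part
  is found on the direction space of P and extended to the whole space through a basis, so that the
  rules for \<open>linear\<close> apply later.\<close>

lemma affine_linear_on_obtain_linear:
  fixes l :: "'a::euclidean_space \<Rightarrow> real"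
  assumes P: "affine P" "p \<in> P" and l: "affine_linear_on P l"
  obtains g where "linear g" "\<And>x. x \<in> P \<Longrightarrow> l x = l p + g (x - p)"
proof -
  define S where "S = (\<lambda>x. x - p) ` P"
  define f where "f w = l (p + w) - l p" for w
  have S: "subspace S"
    unfolding S_def using affine_diffs_subspace_subtract[OF P] .
  have inP: "p + w \<in> P" if "w \<in> S" for w using that by (auto simp: S_def)
  have scale: "f (t *\<^sub>R w) = t * f w" if "w \<in> S" for t w
  proof -
    have "l ((1 - t) *\<^sub>R p + t *\<^sub>R (p + w)) = (1 - t) * l p + t * l (p + w)"
      using l P(2) inP[OF that] unfolding affine_linear_on_def by blast
    then show ?thesis by (simp add: f_def algebra_simps)
  qed
  have add: "f (v + w) = f v + f w" if "v \<in> S" "w \<in> S" for v w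
  proof -
    \<comment> \<open>Additivity comes from the midpoint of the points displaced by twice
      \<open>v\<close> and twice \<open>w\<close>; homogeneity cancels the factors 2.\<close>
    have 2: "2 *\<^sub>R v \<in> S" "2 *\<^sub>R w \<in> S" using that S by (auto simp: subspace_scale)
    have "l ((1 - 1/2) *\<^sub>R (p + 2 *\<^sub>R v) + (1/2) *\<^sub>R (p + 2 *\<^sub>R w))
      = (1 - 1/2) * l (p + 2 *\<^sub>R v) + (1/2) * l (p + 2 *\<^sub>R w)"
      using l inP[OF 2(1)] inP[OF 2(2)] unfolding affine_linear_on_def by blast
    moreover have "(1 - 1/2) *\<^sub>R (p + 2 *\<^sub>R v) + (1/2) *\<^sub>R (p + 2 *\<^sub>R w) = p + (v + w)"
      by (simp add: algebra_simps flip: scaleR_add_left)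
    ultimately have "f (v + w) = (f (2 *\<^sub>R v) + f (2 *\<^sub>R w)) / 2"
      by (simp add: f_def field_simps)
    then show ?thesis using scale[OF that(1)] scale[OF that(2)] by simp
  qed
  obtain B where B: "B \<subseteq> S" "independent B" "S \<subseteq> span B"
    using basis_exists[of S] by metis
  obtain g where g: "linear g" "\<And>x. x \<in> B \<Longrightarrow> g x = f x"
    using linear_independent_extend[OF B(2), of f] by blast
  have "subspace {w \<in> S. g w = f w}"
    using S add scale scale[of 0 0] unfolding subspace_def
    by (auto simp: linear_add[OF g(1)] linear_scale[OF g(1)] linear_0[OF g(1)])
  then have "span B \<subseteq> {w \<in> S. g w = f w}"
    using B(1) g(2) by (intro span_minimal) auto
  then have "g (x - p) = f (x - p)" if "x \<in> P" for x
    using that B(3) by (auto simp: S_def)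
  then show ?thesis using that[OF g(1)] by (simp add: f_def)
qed

lemma affine_linear_on_continuous_on:
  fixes l :: "'a::euclidean_space \<Rightarrow> real"
  assumes "affine P" "affine_linear_on P l"
  shows "continuous_on P l"
proof (cases "P = {}")
  case False
  then obtain p where "p \<in> P" by blast
  then obtain g where g: "linear g" "\<And>x. x \<in> P \<Longrightarrow> l x = l p + g (x - p)"
    using affine_linear_on_obtain_linear assms by blast
  have "continuous_on P (\<lambda>x. l p + g (x - p))"
    by (intro continuous_on_add continuous_on_const linear_continuous_on_compose[OF _ g(1)]
        continuous_on_diff continuous_on_id)
  then show ?thesis
    by (subst continuous_on_cong[OF refl g(2)])
qed simp

text \<open>At a maximum of \<open>m - l\<close> plus the quadratic perturbation, expanding the
  square about \<open>x\<close> gives a linear term, absorbed into \<open>g\<close>, and the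
  strictly concave rest with \<delta> equal to the size of the perturbation.\<close>

lemma real_touching_point:
  fixes m :: "'a::euclidean_space \<Rightarrow> real"
  assumes P: "affine P" and l: "affine_linear_on P l"
    and m: "continuous_on (cball c r \<inter> P) m"
    and bd: "\<And>x. x \<in> sphere c r \<inter> P \<Longrightarrow> m x \<le> l x"
    and y: "y \<in> cball c r \<inter> P" "l y < m y"
  obtains x g \<delta> where "x \<in> ball c r \<inter> P" "linear g" "\<delta> > 0"
    "\<And>w. x + w \<in> cball c r \<inter> P \<Longrightarrow> m (x + w) \<le> m x + g w - \<delta> * (norm w)\<^sup>2"
proof -
  have "continuous_on (cball c r \<inter> P) (\<lambda>x. m x - l x)"
    using m affine_linear_on_continuous_on[OF P l]
    by (intro continuous_intros) (auto elim: continuous_on_subset)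
  then obtain \<epsilon> x where \<epsilon>: "\<epsilon> > 0" and x: "x \<in> ball c r \<inter> P" and
    max: "\<And>z. z \<in> cball c r \<inter> P \<Longrightarrow>
      (m z - l z) + \<epsilon> * (norm (z - c))\<^sup>2 \<le> (m x - l x) + \<epsilon> * (norm (x - c))\<^sup>2"
    by (rule obtain_interior_peak[where P = P and c = c and r = r and y = y])
      (use affine_closed[OF P] bd y in auto)
  obtain g where g: "linear g" "\<And>z. z \<in> P \<Longrightarrow> l z = l x + g (z - x)"
    using affine_linear_on_obtain_linear[OF P _ l] x by blast
  show ?thesis
  proof
    show "x \<in> ball c r \<inter> P" "\<epsilon> > 0" by fact+
    show "linear (\<lambda>w. g w - 2 * \<epsilon> * ((x - c) \<bullet> w))"
      by (intro linear_compose_sub g(1) linearI) (auto simp: algebra_simps inner_simps)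
    fix w assume w: "x + w \<in> cball c r \<inter> P"
    have sq: "norm (x + w - c) ^ 2 = norm (x - c) ^ 2 + 2 * ((x - c) \<bullet> w) + norm w ^ 2"
      by (simp add: power2_norm_eq_inner inner_simps inner_commute)
    have "\<epsilon> * norm (x + w - c) ^ 2 =
        \<epsilon> * norm (x - c) ^ 2 + 2 * \<epsilon> * ((x - c) \<bullet> w) + \<epsilon> * norm w ^ 2"
      unfolding sq by (simp only: distrib_left mult.assoc mult.left_commute)
    then show "m (x + w) \<le> m x + (g w - 2 * \<epsilon> * ((x - c) \<bullet> w)) - \<epsilon> * (norm w)\<^sup>2"
      using max[OF w] g(2)[of "x + w"] w by simp
  qed
qed

section \<open>Touching points below pluriharmonic majorants\<close>

lemma linear_scalar_mult_left: "linear (\<lambda>\<zeta>. \<zeta> *s v)" for v :: "complex^'n::finite"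
  by (intro linearI) (simp_all add: vec_eq_iff algebra_simps)

text \<open>The sum is the Laplacian at 0 of \<open>h\<close> restricted to the complex line through
  \<open>z\<close> in direction \<open>v\<close>. Since \<open>harmonic_on\<close> supplies
  derivatives of its own, uniqueness is used to identify them with those coming from
  \<open>D1\<close> and \<open>D2\<close>.\<close>

lemma pluriharmonic_second_derivative:
  assumes h: "pluriharmonic_on U h" and "open U" and C2: "C2_on_with U h D1 D2" and "z \<in> U"
  shows "D2 z v v + D2 z (\<i> *s v) (\<i> *s v) = 0"
proof -
  define L where "L \<zeta> = z + \<zeta> *s v" for \<zeta>
  define W where "W = {\<zeta>. L \<zeta> \<in> U}"
  have bl: "bounded_linear (\<lambda>\<zeta>. \<zeta> *s v)"
    using linear_scalar_mult_left linear_conv_bounded_linear by blast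
  have L: "(L has_derivative (\<lambda>\<xi>. \<xi> *s v)) (at \<zeta>)" for \<zeta>
    unfolding L_def
    using has_derivative_add[OF has_derivative_const bounded_linear_imp_has_derivative[OF bl]] by simp
  then have "continuous_on UNIV L"
    by (intro continuous_at_imp_continuous_on) (auto intro: has_derivative_continuous)
  then have "open W"
    unfolding W_def using \<open>open U\<close> open_vimage[of U L] by (simp add: vimage_def)
  have "0 \<in> W" using \<open>z \<in> U\<close> by (simp add: W_def L_def)
  obtain E1 E2 where E: "C2_on_with W (\<lambda>\<zeta>. h (L \<zeta>)) E1 E2"
    and tr: "\<And>\<zeta>. \<zeta> \<in> W \<Longrightarrow> E2 \<zeta> 1 1 + E2 \<zeta> \<i> \<i> = 0"
    using h unfolding pluriharmonic_on_def harmonic_on_def W_def L_def by blast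
  have E1: "D1 (L \<zeta>) (\<xi> *s v) = E1 \<zeta> \<xi>" if "\<zeta> \<in> W" for \<zeta> \<xi>
  proof -
    have "(h has_derivative D1 (L \<zeta>)) (at (L \<zeta>))"
      using C2 that by (simp add: C2_on_with_def W_def)
    from has_derivative_compose[OF L this]
    have "((\<lambda>\<zeta>. h (L \<zeta>)) has_derivative (\<lambda>\<xi>. D1 (L \<zeta>) (\<xi> *s v))) (at \<zeta>)" .
    moreover have "((\<lambda>\<zeta>. h (L \<zeta>)) has_derivative E1 \<zeta>) (at \<zeta>)"
      using E that by (simp add: C2_on_with_def)
    ultimately show ?thesis by (metis has_derivative_unique)
  qed
  have E2: "D2 z (\<xi> *s v) (\<eta> *s v) = E2 0 \<xi> \<eta>" for \<xi> \<eta>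
  proof -
    have "(D1 has_derivative D2 (L 0)) (at (L 0))"
      using C2 \<open>0 \<in> W\<close> by (simp add: C2_on_with_def W_def)
    from has_derivative_compose[OF L this]
    have "((\<lambda>\<zeta>. D1 (L \<zeta>)) has_derivative (\<lambda>\<xi>. D2 (L 0) (\<xi> *s v))) (at 0)" .
    then have "((\<lambda>\<zeta>. D1 (L \<zeta>) (\<eta> *s v)) has_derivative (\<lambda>\<xi>. D2 (L 0) (\<xi> *s v) (\<eta> *s v))) (at 0)"
      by (auto intro!: derivative_eq_intros)
    \<comment> \<open>The first derivatives agree on the whole open set \<open>W\<close>, not only
      at 0, which permits differentiating once more.\<close>
    then have "((\<lambda>\<zeta>. E1 \<zeta> \<eta>) has_derivative (\<lambda>\<xi>. D2 (L 0) (\<xi> *s v) (\<eta> *s v))) (at 0)"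
      using \<open>open W\<close> \<open>0 \<in> W\<close> by (rule has_derivative_transform_within_open) (rule E1)
    moreover have "(E1 has_derivative E2 0) (at 0)"
      using E \<open>0 \<in> W\<close> by (simp add: C2_on_with_def)
    then have "((\<lambda>\<zeta>. E1 \<zeta> \<eta>) has_derivative (\<lambda>\<xi>. E2 0 \<xi> \<eta>)) (at 0)"
      by (auto intro!: derivative_eq_intros)
    ultimately have "(\<lambda>\<xi>. D2 (L 0) (\<xi> *s v) (\<eta> *s v)) = (\<lambda>\<xi>. E2 0 \<xi> \<eta>)"
      by (rule has_derivative_unique)
    then show ?thesis by (simp add: L_def fun_eq_iff)
  qed
  show ?thesis
    using E2[of 1 1] E2[of \<i> \<i>] tr[OF \<open>0 \<in> W\<close>] by simp
qed

text \<open>P has real dimension 2k, but the vanishing Laplacians guarantee negativity only on a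
  real subspace S of dimension k. On S, the Taylor bound for \<open>h\<close> at an interior peak
  becomes strictly concave.\<close>

lemma pluriharmonic_touching_point:
  fixes m :: "complex^'n::finite \<Rightarrow> real"
  assumes P: "complex_affine_subspace k P" and U: "open U" "cball c r \<subseteq> U"
    and h: "pluriharmonic_on U h"
    and m: "continuous_on (cball c r \<inter> P) m"
    and bd: "\<And>z. z \<in> sphere c r \<inter> P \<Longrightarrow> m z \<le> h z"
    and y: "y \<in> cball c r \<inter> P" "h y < m y"
  obtains z S g \<delta> \<rho> where "z \<in> ball c r \<inter> P" "subspace S" "dim S = k"
    "linear g" "\<delta> > 0" "\<rho> > 0"
    "\<And>v. v \<in> S \<Longrightarrow> norm v < \<rho> \<Longrightarrow> z + v \<in> cball c r \<inter> P"
    "\<And>v. v \<in> S \<Longrightarrow> norm v < \<rho> \<Longrightarrow> m (z + v) \<le> m z + g v - \<delta> * (norm v)\<^sup>2"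
proof -
  obtain p V where V: "vec.subspace V" "vec.dim V = k" and PV: "P = (\<lambda>v. p + v) ` V"
    using P unfolding complex_affine_subspace_def by blast
  have "closed V"
    using closed_subspace complex_subspace_imp_subspace V(1) by blast
  then have "closed P" unfolding PV by (rule closed_translation)
  obtain D1 D2 where C2: "C2_on_with U h D1 D2"
    using h unfolding pluriharmonic_on_def by blast
  then have "continuous_on U h"
    unfolding C2_on_with_def
    by (meson continuous_at_imp_continuous_on has_derivative_continuous)
  then have "continuous_on (cball c r \<inter> P) (\<lambda>z. m z - h z)"
    using m U(2) by (intro continuous_on_diff) (auto elim: continuous_on_subset)
  then obtain \<epsilon> z where \<epsilon>: "\<epsilon> > 0" and z: "z \<in> ball c r \<inter> P" and
    max: "\<And>x. x \<in> cball c r \<inter> P \<Longrightarrow>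
      (m x - h x) + \<epsilon> * (norm (x - c))\<^sup>2 \<le> (m z - h z) + \<epsilon> * (norm (z - c))\<^sup>2"
    by (rule obtain_interior_peak[where P = P and c = c and r = r and y = y])
      (use \<open>closed P\<close> bd y in auto)
  have "z \<in> U" using z U(2) by auto
  \<comment> \<open>The second derivative is symmetrised because \<open>C2_on_with\<close> does not
    state its symmetry. Only half of the curvature of the perturbation enters here; the other half
    pays for the Taylor error and the final strict concavity.\<close>
  define H where "H v w = (D2 z v w + D2 z w v) / 2 - \<epsilon> * (v \<bullet> w)" for v w
  have "\<exists>S. subspace S \<and> S \<subseteq> V \<and> dim S = k \<and> (\<forall>v\<in>S. v \<noteq> 0 \<longrightarrow> H v v < 0)"
  proof (rule exists_negative_definite_subspace[where H = H, OF _ _ V(1)])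
    show "linear (\<lambda>v. H v w)" for w
      unfolding H_def
      by (intro linearI) (auto simp: blinfun.add_left blinfun.add_right blinfun.scaleR_left
          blinfun.scaleR_right inner_simps field_simps)
    show "H v w = H w v" for v w by (simp add: H_def inner_commute)
    fix v :: "complex^'n" assume "v \<noteq> 0"
    have "H v v + H (\<i> *s v) (\<i> *s v) =
      - (\<epsilon> * (v \<bullet> v)) - \<epsilon> * ((\<i> *s v) \<bullet> (\<i> *s v))"
      using pluriharmonic_second_derivative[OF h U(1) C2 \<open>z \<in> U\<close>, of v] by (simp add: H_def)
    also have "\<dots> < 0"
    proof -
      have "0 < \<epsilon> * (v \<bullet> v)" using \<epsilon> \<open>v \<noteq> 0\<close> by simp
      moreover have "0 \<le> \<epsilon> * ((\<i> *s v) \<bullet> (\<i> *s v))" using \<epsilon> by simp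
      ultimately show ?thesis by linarith
    qed
    finally show "H v v + H (\<i> *s v) (\<i> *s v) < 0" .
  qed (simp add: V(2))
  then obtain S where S: "subspace S" "S \<subseteq> V" "dim S = k" "\<And>v. v \<in> S \<Longrightarrow> v \<noteq> 0 \<Longrightarrow> H v v < 0"
    by blast
  have D2le: "D2 z v v \<le> \<epsilon> * (norm v)\<^sup>2" if "v \<in> S" for v
    using S(4)[OF that] by (cases "v = 0") (auto simp: H_def power2_norm_eq_inner)
  obtain \<rho>1 where \<rho>1: "\<rho>1 > 0" "\<And>v. norm v < \<rho>1 \<Longrightarrow>
      h (z + v) \<le> h z + D1 z v + (D2 z v v + \<epsilon> / 2 * (norm v)\<^sup>2) / 2"
    using C2_second_order_upper_bound[OF C2 U(1) \<open>z \<in> U\<close>, of "\<epsilon> / 2"] \<epsilon> by (metis half_gt_zero)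
  define \<rho> where "\<rho> = min \<rho>1 (r - dist c z)"
  have inK: "z + v \<in> cball c r \<inter> P" if "v \<in> S" "norm v < \<rho>" for v
  proof
    have "dist c (z + v) \<le> dist c z + norm v"
      using dist_triangle[of c "z + v" z] by (simp add: dist_norm)
    then show "z + v \<in> cball c r" using that(2) by (simp add: \<rho>_def)
    obtain v0 where "z = p + v0" "v0 \<in> V" using z by (auto simp: PV)
    then show "z + v \<in> P"
      using that(1) S(2) V(1) by (auto simp: PV add.assoc vec.subspace_add)
  qed
  show ?thesis
  proof (rule that[OF z S(1) S(3)])
    show "linear (\<lambda>v. D1 z v - 2 * \<epsilon> * ((z - c) \<bullet> v))"
      by (intro linearI) (auto simp: blinfun.add_right blinfun.scaleR_right algebra_simps inner_simps)
    \<comment> \<open>Of the perturbation \<epsilon>, one half is spent on the bound for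
      \<open>D2\<close> on S and one quarter on the Taylor error.\<close>
    show "\<epsilon> / 4 > 0" using \<epsilon> by simp
    show "\<rho> > 0" using \<rho>1(1) z by (simp add: \<rho>_def)
    fix v assume v: "v \<in> S" "norm v < \<rho>"
    then show "z + v \<in> cball c r \<inter> P" by (rule inK)
    have sq: "norm (z + v - c) ^ 2 = norm (z - c) ^ 2 + 2 * ((z - c) \<bullet> v) + norm v ^ 2"
      by (simp add: power2_norm_eq_inner inner_simps inner_commute)
    have "\<epsilon> * norm (z + v - c) ^ 2 =
        \<epsilon> * norm (z - c) ^ 2 + 2 * \<epsilon> * ((z - c) \<bullet> v) + \<epsilon> * norm v ^ 2"
      unfolding sq by (simp only: distrib_left mult.assoc mult.left_commute)
    moreover have "norm v < \<rho>1" using v(2) by (simp add: \<rho>_def)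
    ultimately show "m (z + v) \<le> m z + (D1 z v - 2 * \<epsilon> * ((z - c) \<bullet> v)) - \<epsilon> / 4 * (norm v)\<^sup>2"
      using max[OF inK[OF v]] \<rho>1(2)[of v] D2le[OF v(1)] by (simp add: field_simps)
  qed
qed

text \<open>The linear terms at opposite points cancel, leaving the negative quadratic ones. This
  excludes touching for functions that are midpoint convex along some direction of S.\<close>

lemma touching_not_midpoint_convex:
  fixes m :: "'a::real_normed_vector \<Rightarrow> real"
  assumes "subspace S" "linear g" "\<delta> > 0" "\<rho> > 0"
    and touch: "\<And>v. v \<in> S \<Longrightarrow> norm v < \<rho> \<Longrightarrow> m (z + v) \<le> m z + g v - \<delta> * (norm v)\<^sup>2"
    and v: "v \<in> S" "v \<noteq> 0"
  obtains t where "norm (t *\<^sub>R v) < \<rho>" "m (z + t *\<^sub>R v) + m (z - t *\<^sub>R v) < 2 * m z"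
proof
  define t where "t = \<rho> / (2 * norm v)"
  have t: "t > 0" using assms by (simp add: t_def)
  show n: "norm (t *\<^sub>R v) < \<rho>" using assms by (simp add: t_def)
  have tS: "t *\<^sub>R v \<in> S" "- (t *\<^sub>R v) \<in> S"
    using assms by (auto simp: subspace_scale subspace_neg)
  have "m (z + t *\<^sub>R v) \<le> m z + g (t *\<^sub>R v) - \<delta> * (norm (t *\<^sub>R v))\<^sup>2"
    using touch[OF tS(1)] n by simp
  moreover have "m (z - t *\<^sub>R v) \<le> m z - g (t *\<^sub>R v) - \<delta> * (norm (t *\<^sub>R v))\<^sup>2"
    using touch[OF tS(2)] n linear_neg[OF \<open>linear g\<close>] by simp
  moreover have "0 < \<delta> * (norm (t *\<^sub>R v))\<^sup>2"
    using t v \<open>\<delta> > 0\<close> by simp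
  ultimately show "m (z + t *\<^sub>R v) + m (z - t *\<^sub>R v) < 2 * m z" by linarith
qed


section \<open>From real q-convexity to q-pseudoconvexity\<close>

lemma linear_left_inverse_on_bound:
  fixes f :: "'a::euclidean_space \<Rightarrow> 'b::euclidean_space"
  assumes "linear f" "subspace S" and inj: "\<And>v. v \<in> S \<Longrightarrow> f v = 0 \<Longrightarrow> v = 0"
  obtains s M where "linear s" "\<And>v. v \<in> S \<Longrightarrow> s (f v) = v" "M > 0"
    "\<And>x. norm (s x) \<le> M * norm x" "dim (f ` S) = dim S" "subspace (f ` S)"
proof -
  have inj': "inj_on f S"
  proof (rule inj_onI)
    fix v w assume "v \<in> S" "w \<in> S" "f v = f w"
    then have "v - w = 0"
      using assms by (intro inj) (auto simp: subspace_diff linear_diff)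
    then show "v = w" by simp
  qed
  obtain s where s: "linear s" "\<And>v. v \<in> S \<Longrightarrow> s (f v) = v"
    using linear_exists_left_inverse_on[OF assms(1,2) inj'] by blast
  obtain M where M: "M > 0" "\<And>x. norm (s x) \<le> M * norm x"
    using linear_bounded_pos[OF s(1)] by (metis mult.commute)
  have "dim (f ` S) = dim S"
    using dim_image_eq[OF assms(1)] inj' assms(2) by (metis span_eq_iff)
  then show ?thesis
    using that s M linear_subspace_image assms(1,2) by blast
qed

text \<open>The function is constant in imaginary directions, so strict concavity makes
  \<open>vec_Re\<close> injective on S, and the image spans a real plane of the right dimension. The
  left inverse carries \<open>g\<close> to this plane, where the maximum principle fails at the
  centre of a small ball.\<close>

lemma real_q_convex_set_no_touching:
  fixes \<omega> :: "(real^'n::finite) set"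
  assumes q: "real_q_convex_set q \<omega>" and fr: "frontier \<omega> \<noteq> {}" and z: "vec_Re z \<in> \<omega>"
    and S: "subspace S" "dim S = q + 1" and g: "linear g" and pos: "\<delta> > 0" "\<rho> > 0"
    and in_\<omega>: "\<And>v. v \<in> S \<Longrightarrow> norm v < \<rho> \<Longrightarrow> vec_Re (z + v) \<in> \<omega>"
    and touch: "\<And>v. v \<in> S \<Longrightarrow> norm v < \<rho> \<Longrightarrow>
      - ln (infdist (vec_Re (z + v)) (frontier \<omega>)) \<le>
      - ln (infdist (vec_Re z) (frontier \<omega>)) + g v - \<delta> * (norm v)\<^sup>2"
  shows False
proof -
  define u where "u x = - ln (infdist x (frontier \<omega>))" for x
  note touch_u = touch[folded u_def]
  have "open \<omega>" using q by (simp add: real_q_convex_set_def)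
  have u_iff: "ball y (exp (- b)) \<subseteq> \<omega> \<longleftrightarrow> u y \<le> b" if "y \<in> \<omega>" for y b
    unfolding u_def using ball_exp_subset_iff[OF \<open>open \<omega>\<close> that fr] .
  have inj: "v = 0" if v: "v \<in> S" "vec_Re v = 0" for v
  proof (rule ccontr)
    assume "v \<noteq> 0"
    obtain t where "u (vec_Re (z + t *\<^sub>R v)) + u (vec_Re (z - t *\<^sub>R v)) < 2 * u (vec_Re z)"
      using touching_not_midpoint_convex[OF S(1) g pos, of "\<lambda>z. u (vec_Re z)" z v]
        touch_u v(1) \<open>v \<noteq> 0\<close> by blast
    then show False
      using v(2) by (simp add: linear_add[OF linear_vec_Re] linear_diff[OF linear_vec_Re]
          linear_scale[OF linear_vec_Re])
  qed
  obtain s M where s: "linear s" "\<And>v. v \<in> S \<Longrightarrow> s (vec_Re v) = v" "M > 0"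
    "\<And>x. norm (s x) \<le> M * norm x" and L: "dim (vec_Re ` S) = dim S" "subspace (vec_Re ` S)"
    using linear_left_inverse_on_bound[OF linear_vec_Re S(1) inj] by blast
  define x where "x = vec_Re z"
  define P where "P = (+) x ` (vec_Re ` S)"
  obtain r0 where r0: "r0 > 0" "cball x r0 \<subseteq> \<omega>"
    using \<open>open \<omega>\<close> z unfolding x_def by (meson open_contains_cball)
  \<comment> \<open>Points of the plane at distance \<open>r\<close> from \<open>x\<close> lift to
    vectors of norm at most \<open>M * r\<close>, which is less than \<rho>, so the touching
    inequality applies to them.\<close>
  define r where "r = min r0 (\<rho> / (2 * M))"
  have r: "r > 0" "cball x r \<subseteq> \<omega>"
    using r0 pos s(3) by (auto simp: r_def)
  have "M * r \<le> M * (\<rho> / (2 * M))"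
    using s(3) by (intro mult_left_mono) (auto simp: r_def)
  also have "\<dots> < \<rho>" using s(3) pos by simp
  finally have Mr: "M * r < \<rho>" .
  \<comment> \<open>Replacing the quadratic term by a constant makes \<open>l\<close> affine. It
    still majorises \<open>u\<close> on the sphere, since a lift is at least as long as its real
    part, but it lies below \<open>u\<close> at \<open>x\<close>.\<close>
  define l where "l y = u x + g (s (y - x)) - \<delta> * r\<^sup>2" for y
  have "affine P"
    unfolding P_def by (rule affine_translation[THEN iffD1, OF subspace_imp_affine[OF L(2)]])
  moreover have "aff_dim P = int q + 1"
    unfolding P_def using aff_dim_subspace[OF L(2)] L(1) S(2) by (simp add: aff_dim_translation_eq)
  moreover have "affine_linear_on P l"
  proof -
    have "(1 - t) *\<^sub>R a + t *\<^sub>R b - x = (1 - t) *\<^sub>R (a - x) + t *\<^sub>R (b - x)" for a b t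
      by (simp add: algebra_simps)
    then show ?thesis
      unfolding affine_linear_on_def l_def
      by (simp add: linear_add[OF s(1)] linear_scale[OF s(1)] linear_add[OF g] linear_scale[OF g])
        (simp add: algebra_simps)
  qed
  moreover have "ball y (exp (- l y)) \<subseteq> \<omega>" if y: "y \<in> sphere x r \<inter> P" for y
  proof -
    obtain v where v: "v \<in> S" "y = x + vec_Re v"
      using y unfolding P_def by blast
    have nv: "norm (vec_Re v) = r" using y v(2) by (simp add: dist_norm)
    then have "norm v < \<rho>"
      using s(4)[of "vec_Re v"] s(2)[OF v(1)] Mr by simp
    moreover have yz: "y = vec_Re (z + v)"
      using v(2) by (simp add: x_def linear_add[OF linear_vec_Re])
    ultimately have "y \<in> \<omega>" "u y \<le> u x + g v - \<delta> * (norm v)\<^sup>2"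
      using in_\<omega> touch_u v(1) by (simp_all add: x_def)
    moreover have "\<delta> * r\<^sup>2 \<le> \<delta> * (norm v)\<^sup>2"
      using norm_vec_Re_le[of v] nv pos r(1) by (intro mult_left_mono power_mono) auto
    moreover have "l y = u x + g v - \<delta> * r\<^sup>2"
      using s(2)[OF v(1)] v(2) by (simp add: l_def)
    ultimately have "y \<in> \<omega>" "u y \<le> l y" by linarith+
    then show ?thesis using u_iff by blast
  qed
  ultimately have "\<forall>y\<in>cball x r \<inter> P. ball y (exp (- l y)) \<subseteq> \<omega>"
    using q r unfolding real_q_convex_set_iff[OF \<open>open \<omega>\<close>] by blast
  moreover have "x \<in> cball x r \<inter> P"
    unfolding P_def using r(1) subspace_0[OF L(2)] by force
  ultimately have "ball x (exp (- l x)) \<subseteq> \<omega>" by blast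
  then have "u x \<le> l x"
    using u_iff z unfolding x_def by blast
  moreover have "l x = u x - \<delta> * r\<^sup>2"
    using linear_0[OF s(1)] linear_0[OF g] by (simp add: l_def)
  moreover have "\<delta> * r\<^sup>2 > 0" using pos r(1) by simp
  ultimately show False by linarith
qed

text \<open>By \<open>ball_subset_tube_iff\<close> the claim splits into one on \<omega> and one for
  each imaginary coordinate. Each is a maximum principle for a single function, whose failure would
  produce a touching point.\<close>

theorem q_pseudoconvex_tube_if_real_q_convex_set:
  fixes \<omega> :: "(real^'n::finite) set"
  assumes q: "real_q_convex_set q \<omega>"
  shows "q_pseudoconvex q (tube \<omega> a)"
proof -
  have "open \<omega>" using q by (simp add: real_q_convex_set_def)
  show ?thesis
    unfolding q_pseudoconvex_iff[OF open_tube[OF \<open>open \<omega>\<close>]]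
  proof (intro allI impI ballI)
    fix P c r U h z
    assume P: "complex_affine_subspace (q + 1) P" and U: "open U" "cball c r \<subseteq> U"
      and h: "pluriharmonic_on U h" and K: "cball c r \<subseteq> tube \<omega> a"
      and bd: "\<forall>z\<in>sphere c r \<inter> P. ball z (exp (- h z)) \<subseteq> tube \<omega> a"
      and z: "z \<in> cball c r \<inter> P"
    note iff = ball_subset_tube_iff[OF exp_gt_zero]
    have Re_K: "vec_Re w \<in> \<omega>" and Im_K: "ereal \<bar>Im (w $ k)\<bar> < a"
      if "w \<in> cball c r \<inter> P" for w k
      using that K by (auto simp: mem_tube_iff)
    have sph: "w \<in> cball c r \<inter> P" if "w \<in> sphere c r \<inter> P" for w
      using that by auto
    have "ball (vec_Re z) (exp (- h z)) \<subseteq> \<omega>"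
    proof (cases "frontier \<omega> = {}")
      \<comment> \<open>A nonempty set with empty frontier is the whole space.\<close>
      case True
      then show ?thesis using Re_K[OF z] by (auto simp: frontier_eq_empty)
    next
      case fr: False
      define m where "m w = - ln (infdist (vec_Re w) (frontier \<omega>))" for w
      have le_iff: "ball (vec_Re w) (exp (- h w)) \<subseteq> \<omega> \<longleftrightarrow> m w \<le> h w" if "w \<in> cball c r \<inter> P" for w
        unfolding m_def using ball_exp_subset_iff[OF \<open>open \<omega>\<close> Re_K[OF that] fr] .
      have "continuous_on (cball c r \<inter> P) m"
        unfolding m_def
        by (rule continuous_on_compose2[OF continuous_on_neg_ln_infdist[OF \<open>open \<omega>\<close> fr]])
          (use Re_K in \<open>auto intro!: linear_continuous_on simp: linear_linear linear_vec_Re\<close>)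
      note touching = pluriharmonic_touching_point[OF P U h this, of z]
      show ?thesis
      proof (rule ccontr)
        assume "\<not> ?thesis"
        then have lt: "h z < m z" using le_iff[OF z] by simp
        have le: "m w \<le> h w" if "w \<in> sphere c r \<inter> P" for w
          using bd that le_iff[OF sph[OF that]] iff by blast
        obtain z1 S g \<delta> \<rho> where z1: "z1 \<in> ball c r \<inter> P" and S: "subspace S" "dim S = q + 1"
          "linear g" "\<delta> > 0" "\<rho> > 0"
          and in_K: "\<And>v. v \<in> S \<Longrightarrow> norm v < \<rho> \<Longrightarrow> z1 + v \<in> cball c r \<inter> P"
          and touch: "\<And>v. v \<in> S \<Longrightarrow> norm v < \<rho> \<Longrightarrow> m (z1 + v) \<le> m z1 + g v - \<delta> * (norm v)\<^sup>2"
          by (rule touching[OF le z lt], assumption) (rule that)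
        have "vec_Re z1 \<in> \<omega>" using z1 by (intro Re_K) auto
        then show False
          using real_q_convex_set_no_touching[OF q fr _ S Re_K[OF in_K] touch[unfolded m_def]] by blast
      qed
    qed
    moreover have "ereal (\<bar>Im (z $ k)\<bar> + exp (- h z)) \<le> a" for k
    proof (cases a)
      case (real b)
      \<comment> \<open>Splitting the absolute value into its two signs makes the gap
        \<open>s\<close> real affine, so that \<open>- ln s\<close> is convex.\<close>
      have "\<sigma> * Im (z $ k) + exp (- h z) \<le> b" if \<sigma>: "\<sigma> = 1 \<or> \<sigma> = -1" for \<sigma> :: real
      proof -
        define s where "s w = b - \<sigma> * Im (w $ k)" for w :: "complex^'n"
        have s_pos: "s w > 0" if "w \<in> cball c r \<inter> P" for w
          using Im_K[OF that, of k] real \<sigma> by (auto simp: s_def)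
        define m where "m w = - ln (s w)" for w
        have le_iff: "\<sigma> * Im (w $ k) + exp (- h w) \<le> b \<longleftrightarrow> m w \<le> h w"
          if "w \<in> cball c r \<inter> P" for w
          using ln_ge_iff[OF s_pos[OF that], of "- h w"] by (auto simp: s_def m_def)
        have "continuous_on (cball c r \<inter> P) m"
          unfolding m_def by (intro continuous_intros) (use s_pos in \<open>force simp: s_def intro!: continuous_intros\<close>)+
        note touching = pluriharmonic_touching_point[OF P U h this, of z]
        show ?thesis
        proof (rule ccontr)
          assume "\<not> ?thesis"
          then have lt: "h z < m z" using le_iff[OF z] by simp
          have le: "m w \<le> h w" if w: "w \<in> sphere c r \<inter> P" for w
          proof -
            have "\<bar>Im (w $ k)\<bar> + exp (- h w) \<le> b"
              using bd[rule_format, OF w, unfolded iff] real by simp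
            then show ?thesis using le_iff[OF sph[OF w]] \<sigma> by auto
          qed
          obtain z1 S g \<delta> \<rho> where "z1 \<in> ball c r \<inter> P" and S: "subspace S" "dim S = q + 1"
            "linear g" "\<delta> > 0" "\<rho> > 0"
            and in_K: "\<And>v. v \<in> S \<Longrightarrow> norm v < \<rho> \<Longrightarrow> z1 + v \<in> cball c r \<inter> P"
            and touch: "\<And>v. v \<in> S \<Longrightarrow> norm v < \<rho> \<Longrightarrow>
              m (z1 + v) \<le> m z1 + g v - \<delta> * (norm v)\<^sup>2"
            by (rule touching[OF le z lt], assumption) (rule that)
          obtain v where v: "v \<in> S" "v \<noteq> 0"
            using S(2) dim_eq_0[of S] by auto
          obtain t where t: "norm (t *\<^sub>R v) < \<rho>"
            "m (z1 + t *\<^sub>R v) + m (z1 - t *\<^sub>R v) < 2 * m z1"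
            using touching_not_midpoint_convex[OF S(1,3-5) touch v] by blast
          have tv: "t *\<^sub>R v \<in> S" "- (t *\<^sub>R v) \<in> S"
            using v(1) S(1) by (auto simp: subspace_scale subspace_neg)
          have pos: "s (z1 + t *\<^sub>R v) > 0" "s (z1 - t *\<^sub>R v) > 0" "s z1 > 0"
            using s_pos[OF in_K[OF tv(1) t(1)]] s_pos[OF in_K[OF tv(2)]] t(1)
              s_pos[OF in_K[OF subspace_0[OF S(1)]]] S(5) by auto
          define e where "e = \<sigma> * Im ((t *\<^sub>R v) $ k)"
          have eqs: "s (z1 + t *\<^sub>R v) = s z1 - e" "s (z1 - t *\<^sub>R v) = s z1 + e"
            by (simp_all add: s_def e_def algebra_simps)
          \<comment> \<open>The product is \<open>s z1\<close> squared minus \<open>e\<close>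
            squared; after taking logarithms this is the midpoint convexity that contradicts
            touching.\<close>
          have "s (z1 + t *\<^sub>R v) * s (z1 - t *\<^sub>R v) \<le> s z1 * s z1"
            unfolding eqs by (simp add: algebra_simps)
          then have "ln (s (z1 + t *\<^sub>R v) * s (z1 - t *\<^sub>R v)) \<le> ln (s z1 * s z1)"
            using pos by (intro ln_mono) auto
          then show False using t(2) pos by (simp add: ln_mult m_def)
        qed
      qed
      from this[of 1] this[of "-1"] have "\<bar>Im (z $ k)\<bar> + exp (- h z) \<le> b" by auto
      then show ?thesis using real by simp
    \<comment> \<open>For \<infinity> the bound is trivial, and the other infinite value contradicts
      \<open>Im_K\<close>.\<close>
    qed (use Im_K[OF z] in auto)
    ultimately show "ball z (exp (- h z)) \<subseteq> tube \<omega> a"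
      by (simp add: iff)
  qed
qed

section \<open>Pluriharmonic quadratic polynomials\<close>

text \<open>Brings a bilinear form into the nested type that \<open>C2_on_with\<close> demands of
  second derivatives.\<close>

definition blinfun_of_bilinear ::
    "('a::euclidean_space \<Rightarrow> 'a \<Rightarrow> real) \<Rightarrow> 'a \<Rightarrow>\<^sub>L 'a \<Rightarrow>\<^sub>L real" where
  "blinfun_of_bilinear B = Blinfun (\<lambda>v. Blinfun (B v))"

lemma blinfun_of_bilinear_apply:
  assumes B: "bilinear B"
  shows "blinfun_of_bilinear B v w = B v w"
proof -
  have bb: "bounded_bilinear B" using B bilinear_conv_bounded_bilinear by blast
  have 1: "blinfun_apply (Blinfun (B v)) = B v" for v
    by (rule bounded_linear_Blinfun_apply[OF bounded_bilinear.bounded_linear_right[OF bb]])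
  have "linear (\<lambda>v. Blinfun (B v))"
    by (intro linearI blinfun_eqI)
      (simp_all add: 1 blinfun.add_left blinfun.scaleR_left bilinear_ladd[OF B] bilinear_lmul[OF B])
  then have "bounded_linear (\<lambda>v. Blinfun (B v))"
    using linear_conv_bounded_linear by blast
  then show ?thesis
    unfolding blinfun_of_bilinear_def by (simp add: bounded_linear_Blinfun_apply 1)
qed

lemma C2_on_with_quadratic:
  fixes g :: "'a::euclidean_space \<Rightarrow> real" and B :: "'a \<Rightarrow> 'a \<Rightarrow> real"
  assumes g: "linear g" and B: "bilinear B" and sym: "\<And>v w. B v w = B w v"
  shows "C2_on_with U (\<lambda>x. c + g (x - p) + B (x - p) (x - p))
    (\<lambda>x. Blinfun g + 2 *\<^sub>R blinfun_of_bilinear B (x - p)) (\<lambda>x. 2 *\<^sub>R blinfun_of_bilinear B)"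
proof -
  have bl_g: "bounded_linear g" using g linear_conv_bounded_linear by blast
  have bb: "bounded_bilinear B" using B bilinear_conv_bounded_bilinear by blast
  have d: "((\<lambda>x. x - p) has_derivative (\<lambda>v. v)) (at x)" for x
    by (auto intro!: derivative_eq_intros)
  have "((\<lambda>x. c + g (x - p) + B (x - p) (x - p)) has_derivative
      blinfun_apply (Blinfun g + 2 *\<^sub>R blinfun_of_bilinear B (x - p))) (at x)" for x
  proof -
    have "((\<lambda>x. B (x - p) (x - p)) has_derivative (\<lambda>v. B (x - p) v + B v (x - p))) (at x)"
      using bounded_bilinear.FDERIV[OF bb d d] .
    moreover have "((\<lambda>x. g (x - p)) has_derivative g) (at x)"
      using bounded_linear.has_derivative[OF bl_g d] .
    ultimately have "((\<lambda>x. c + g (x - p) + B (x - p) (x - p)) has_derivative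
        (\<lambda>v. 0 + g v + (B (x - p) v + B v (x - p)))) (at x)"
      by (intro has_derivative_add has_derivative_const)
    moreover have "(\<lambda>v. 0 + g v + (B (x - p) v + B v (x - p))) =
        blinfun_apply (Blinfun g + 2 *\<^sub>R blinfun_of_bilinear B (x - p))"
      using sym by (auto simp: blinfun_of_bilinear_apply[OF B] blinfun.add_left blinfun.scaleR_left
          bounded_linear_Blinfun_apply[OF bl_g])
    ultimately show ?thesis by simp
  qed
  moreover have "((\<lambda>x. Blinfun g + 2 *\<^sub>R blinfun_of_bilinear B (x - p)) has_derivative
      blinfun_apply (2 *\<^sub>R blinfun_of_bilinear B)) (at x)" for x
    by (rule has_derivative_eq_rhs[OF has_derivative_add[OF has_derivative_const
          has_derivative_scaleR_right[OF bounded_linear.has_derivative[OF blinfun.bounded_linear_right d]]]])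
      (auto simp: blinfun.scaleR_left)
  ultimately show ?thesis
    unfolding C2_on_with_def by simp
qed

text \<open>On a complex line in direction \<open>b\<close> the Laplacian is twice the sum of
  \<open>B\<close> at \<open>b\<close> and at \<open>\<i> *s b\<close>, which \<open>anti\<close>
  makes zero; affine terms contribute nothing.\<close>

lemma pluriharmonic_on_quadratic:
  fixes g :: "complex^'n::finite \<Rightarrow> real"
  assumes g: "linear g" and B: "bilinear B" and sym: "\<And>v w. B v w = B w v"
    and anti: "\<And>v. B (\<i> *s v) (\<i> *s v) = - B v v"
  shows "pluriharmonic_on U (\<lambda>z. c + g (z - p) + B (z - p) (z - p))"
  unfolding pluriharmonic_on_def
proof (intro conjI allI)
  show "\<exists>D1 D2. C2_on_with U (\<lambda>z. c + g (z - p) + B (z - p) (z - p)) D1 D2"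
    using C2_on_with_quadratic[OF g B sym] by blast
  fix a b :: "complex^'n"
  define W where "W = {\<zeta>. a + \<zeta> *s b \<in> U}"
  \<comment> \<open>The polynomial is recentred at \<zeta> = 0; the cross terms of \<open>B\<close>
    join the linear part.\<close>
  define c' where "c' = c + g (a - p) + B (a - p) (a - p)"
  define g' where "g' \<zeta> = g (\<zeta> *s b) + 2 * B (a - p) (\<zeta> *s b)" for \<zeta>
  define B' where "B' \<zeta> \<xi> = B (\<zeta> *s b) (\<xi> *s b)" for \<zeta> \<xi>
  note lin = linear_scalar_mult_left[of b]
  have g': "linear g'"
    unfolding g'_def by (intro linearI)
      (simp_all add: linear_add[OF lin] linear_scale[OF lin] linear_add[OF g] linear_scale[OF g]
        bilinear_radd[OF B] bilinear_rmul[OF B] algebra_simps)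
  have B': "bilinear B'"
    unfolding B'_def bilinear_def
    by (intro conjI allI linearI) (simp_all add: linear_add[OF lin] linear_scale[OF lin]
        bilinear_ladd[OF B] bilinear_radd[OF B] bilinear_lmul[OF B] bilinear_rmul[OF B])
  have eq: "c + g (a + \<zeta> *s b - p) + B (a + \<zeta> *s b - p) (a + \<zeta> *s b - p) = c' + g' (\<zeta> - 0) + B' (\<zeta> - 0) (\<zeta> - 0)" for \<zeta>
  proof -
    have "a + \<zeta> *s b - p = (a - p) + \<zeta> *s b" by simp
    then show ?thesis
      unfolding c'_def g'_def B'_def
      by (simp only: linear_add[OF g] bilinear_ladd[OF B] bilinear_radd[OF B]
          sym[of "\<zeta> *s b" "a - p"]) simp
  qed
  have "(2 *\<^sub>R blinfun_of_bilinear B') 1 1 + (2 *\<^sub>R blinfun_of_bilinear B') \<i> \<i> = 0"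
    using anti[of b] by (simp add: blinfun.scaleR_left blinfun_of_bilinear_apply[OF B'] B'_def)
  moreover have "B' v w = B' w v" for v w by (simp add: B'_def sym)
  then have "C2_on_with W (\<lambda>\<zeta>. c' + g' (\<zeta> - 0) + B' (\<zeta> - 0) (\<zeta> - 0))
      (\<lambda>\<zeta>. Blinfun g' + 2 *\<^sub>R blinfun_of_bilinear B' (\<zeta> - 0)) (\<lambda>\<zeta>. 2 *\<^sub>R blinfun_of_bilinear B')"
    by (rule C2_on_with_quadratic[OF g' B'])
  ultimately show "harmonic_on {\<zeta>. a + \<zeta> *s b \<in> U}
      (\<lambda>\<zeta>. c + g (a + \<zeta> *s b - p) + B (a + \<zeta> *s b - p) (a + \<zeta> *s b - p))"
    unfolding harmonic_on_def eq W_def by blast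
qed

section \<open>From q-pseudoconvexity to real q-convexity\<close>

text \<open>The vectors whose real and imaginary parts lie in the real span form a complex subspace,
  the complexification. It serves both to count dimensions and to return from the complex plane to
  the real one.\<close>

lemma mem_span_vec_of_realD:
  assumes "z \<in> vec.span (vec_of_real ` B)"
  shows "vec_Re z \<in> span B" "vec_Im z \<in> span B"
proof -
  have "vec.subspace {z. vec_Re z \<in> span B \<and> vec_Im z \<in> span B}"
    unfolding vec.subspace_def
  proof (intro conjI ballI allI)
    fix c :: complex and z assume "z \<in> {z. vec_Re z \<in> span B \<and> vec_Im z \<in> span B}"
    moreover have "vec_Re (c *s z) = Re c *\<^sub>R vec_Re z - Im c *\<^sub>R vec_Im z"
      "vec_Im (c *s z) = Re c *\<^sub>R vec_Im z + Im c *\<^sub>R vec_Re z"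
      by (simp_all add: vec_Re_def vec_Im_def vec_eq_iff)
    ultimately show "c *s z \<in> {z. vec_Re z \<in> span B \<and> vec_Im z \<in> span B}"
      by (simp add: span_add span_diff span_scale)
  qed (simp_all add: linear_0[OF linear_vec_Re] linear_0[OF linear_vec_Im]
      linear_add[OF linear_vec_Re] linear_add[OF linear_vec_Im] span_0 span_add)
  then have "vec.span (vec_of_real ` B) \<subseteq> {z. vec_Re z \<in> span B \<and> vec_Im z \<in> span B}"
    by (rule vec.span_minimal[rotated]) (auto simp: span_base span_0)
  then show "vec_Re z \<in> span B" "vec_Im z \<in> span B" using assms by auto
qed

lemma dim_span_vec_of_real:
  fixes B :: "(real^'n::finite) set"
  assumes "finite B" "independent B"
  shows "vec.dim (vec.span (vec_of_real ` B)) = card B"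
  using assms
proof (induction B rule: finite_induct)
  case empty
  then show ?case by simp
next
  case (insert b B)
  then have B: "independent B" "b \<notin> span B"
    by (auto simp: independent_insert)
  have "vec_of_real b \<notin> vec.span (vec_of_real ` B)"
    using B(2) mem_span_vec_of_realD(1)[of "vec_of_real b" B] by auto
  then show ?case
    using insert B by (simp add: vec.dim_insert)
qed

text \<open>Here \<open>C\<close> is the exact boundary distance at \<open>x\<close>, and a tube
  wider than \<open>C\<close> imposes no constraint through its width near \<open>x\<close>. The
  complexified touching polynomial then violates the maximum principle: at the centre it would give
  a ball of radius larger than \<open>C\<close>, which contains \<open>p\<close>.\<close>

lemma q_pseudoconvex_tube_no_touching:
  fixes \<omega> :: "(real^'n::finite) set"
  assumes q: "q_pseudoconvex q (tube \<omega> a)" and "open \<omega>"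
    and p: "p \<notin> \<omega>" "dist x p = C" "0 < C" "ereal C < a"
    and S: "subspace S" "dim S = q + 1" and g: "linear g" and pos: "\<delta> > 0" "\<rho> > 0"
    and touch: "\<And>w. w \<in> S \<Longrightarrow> norm w < \<rho> \<Longrightarrow>
      ball (x + w) (C * exp (g w + \<delta> * (norm w)\<^sup>2)) \<subseteq> \<omega>"
  shows False
proof -
  obtain K where K: "K > 0" "\<And>w. norm (g w) \<le> K * norm w"
    using linear_bounded_pos[OF g] by (metis mult.commute)
  obtain b where b: "C < b" "ereal b \<le> a"
    using p(4) by (metis ereal_dense2 ereal_less_eq(3) less_ereal.simps(1) less_imp_le)
  \<comment> \<open>The summand \<open>r\<close> bounds the imaginary parts and the other one the
    radii on the sphere. Their sum tends to \<open>C\<close>, so it is below \<open>b\<close> for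
    small \<open>r\<close>.\<close>
  have "((\<lambda>r. r + C * exp (K * r + \<delta> * r\<^sup>2)) \<longlongrightarrow> 0 + C * exp (K * 0 + \<delta> * 0\<^sup>2)) (at_right 0)"
    by (intro tendsto_intros)
  then have "\<forall>\<^sub>F r in at_right 0. r + C * exp (K * r + \<delta> * r\<^sup>2) < b"
    using b(1) by (intro order_tendstoD(2)) auto
  moreover have "\<forall>\<^sub>F r in at_right 0. 0 < r \<and> r < min \<rho> C"
    unfolding eventually_at_right_field using pos p(3) by (intro exI[of _ "min \<rho> C"]) auto
  ultimately have "\<forall>\<^sub>F r in at_right 0. r + C * exp (K * r + \<delta> * r\<^sup>2) < b \<and> 0 < r \<and> r < min \<rho> C"
    by (rule eventually_conj)
  then obtain r where r: "r + C * exp (K * r + \<delta> * r\<^sup>2) < b" "0 < r" "r < \<rho>" "r < C"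
    using eventually_happens'[OF trivial_limit_at_right_real] by auto
  define X where "X = vec_of_real x"
  obtain B where B: "B \<subseteq> S" "independent B" "S \<subseteq> span B" "card B = q + 1"
    using basis_exists[of S] S(2) by metis
  have "span B = S" using B(1,3) S(1) by (simp add: span_minimal subset_antisym)
  define V where "V = vec.span (vec_of_real ` B)"
  define P where "P = (+) X ` V"
  have "vec.dim V = q + 1"
    unfolding V_def using dim_span_vec_of_real B finiteI_independent by metis
  then have P: "complex_affine_subspace (q + 1) P"
    unfolding complex_affine_subspace_def P_def V_def using vec.subspace_span by blast
  \<comment> \<open>Up to the constant factor this is the real part of the complex bilinear product
    of \<open>v\<close> and \<open>w\<close>, so its diagonal is pluriharmonic.\<close>
  define b2 where "b2 v w = - (\<delta> / 2) * (vec_Re v \<bullet> vec_Re w - vec_Im v \<bullet> vec_Im w)"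
    for v w :: "complex^'n"
  \<comment> \<open>On the sphere the squared norms of the real and imaginary parts add up to
    \<open>r\<^sup>2\<close>, so the constant turns the quadratic part into \<delta> times minus the
    squared norm of the real part, as in \<open>touch\<close>. At the centre it leaves a gain of
    \<open>\<delta> * r\<^sup>2 / 2\<close> over \<open>- ln C\<close>.\<close>
  define h where "h z = (- ln C - \<delta> * r\<^sup>2 / 2) + - g (vec_Re (z - X)) + b2 (z - X) (z - X)" for z
  note lin = linear_add[OF linear_vec_Re] linear_scale[OF linear_vec_Re]
    linear_add[OF linear_vec_Im] linear_scale[OF linear_vec_Im]
  have "pluriharmonic_on UNIV h"
    unfolding h_def
  proof (rule pluriharmonic_on_quadratic[where g = "\<lambda>z. - g (vec_Re z)" and B = b2])
    show "linear (\<lambda>z. - g (vec_Re z))"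
      by (intro linearI) (simp_all add: lin linear_add[OF g] linear_scale[OF g])
    show "bilinear b2"
      unfolding bilinear_def b2_def by (intro conjI allI linearI) (simp_all add: lin inner_simps algebra_simps)
    show "b2 v w = b2 w v" for v w by (simp add: b2_def inner_commute)
    show "b2 (\<i> *s v) (\<i> *s v) = - b2 v v" for v
    proof -
      have "vec_Re (\<i> *s v) = - vec_Im v" "vec_Im (\<i> *s v) = vec_Re v"
        by (simp_all add: vec_Re_def vec_Im_def vec_eq_iff)
      then show ?thesis by (simp add: b2_def algebra_simps)
    qed
  qed
  moreover have ball_x: "ball x C \<subseteq> \<omega>"
    using touch[of 0] pos subspace_0[OF S(1)] linear_0[OF g] by simp
  have ReX: "vec_Re X = x" "vec_Im X = 0" by (simp_all add: X_def)
  have Im_le: "\<bar>Im (z $ k)\<bar> \<le> norm (z - X)" for z k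
  proof -
    have "Im (X $ k) = 0" by (simp add: X_def vec_of_real_def)
    then have "\<bar>Im (z $ k)\<bar> = \<bar>Im ((z - X) $ k)\<bar>" by simp
    also have "\<dots> \<le> norm (z - X)"
      by (rule order_trans[OF abs_Im_le_cmod Finite_Cartesian_Product.norm_nth_le])
    finally show ?thesis .
  qed
  have "cball X r \<subseteq> tube \<omega> a"
  proof
    fix z assume "z \<in> cball X r"
    then have z: "norm (z - X) \<le> r" by (simp add: dist_norm norm_minus_commute)
    have "norm (vec_Re z - x) \<le> r"
      using norm_vec_Re_le[of "z - X"] z ReX by (simp add: linear_diff[OF linear_vec_Re])
    then have "vec_Re z \<in> \<omega>"
      using ball_x r(4) by (auto simp: dist_norm norm_minus_commute subset_eq)
    moreover have "ereal \<bar>Im (z $ k)\<bar> < a" for k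
    proof -
      have "0 < C * exp (K * r + \<delta> * r\<^sup>2)" using p(3) by simp
      then have "\<bar>Im (z $ k)\<bar> < b" using Im_le[of z k] z r(1) by linarith
      then show ?thesis using b(2) by (metis less_ereal.simps(1) less_le_trans)
    qed
    ultimately show "z \<in> tube \<omega> a" by (simp add: mem_tube_iff)
  qed
  moreover have "ball z (exp (- h z)) \<subseteq> tube \<omega> a" if z: "z \<in> sphere X r \<inter> P" for z
  proof -
    obtain v where v: "z = X + v" "v \<in> V" using z unfolding P_def by blast
    have nv: "norm v = r" using z v(1) by (simp add: dist_norm)
    have w: "vec_Re v \<in> S" "norm (vec_Re v) \<le> r"
      using mem_span_vec_of_realD(1)[of v B] v(2) \<open>span B = S\<close> norm_vec_Re_le[of v] nv
      by (auto simp: V_def)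
    have "r\<^sup>2 = vec_Re v \<bullet> vec_Re v + vec_Im v \<bullet> vec_Im v"
      using norm_vec_Re_Im[of v] nv by (simp add: power2_norm_eq_inner)
    then have "- h z = ln C + (g (vec_Re v) + \<delta> * (norm (vec_Re v))\<^sup>2)"
      by (simp add: h_def b2_def v(1) power2_norm_eq_inner field_simps)
    then have eq: "exp (- h z) = C * exp (g (vec_Re v) + \<delta> * (norm (vec_Re v))\<^sup>2)"
      using p(3) by (simp add: exp_add)
    have "ball (vec_Re z) (exp (- h z)) \<subseteq> \<omega>"
      unfolding eq using touch[OF w(1)] w(2) r(3) by (simp add: v(1) lin ReX)
    moreover have "ereal (\<bar>Im (z $ k)\<bar> + exp (- h z)) \<le> a" for k
    proof -
      have "g (vec_Re v) \<le> K * r"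
        using K(2)[of "vec_Re v"] mult_left_mono[OF w(2) less_imp_le[OF K(1)]]
        unfolding real_norm_def by linarith
      moreover have "\<delta> * (norm (vec_Re v))\<^sup>2 \<le> \<delta> * r\<^sup>2"
        using w(2) pos by (intro mult_left_mono power_mono) auto
      ultimately have "exp (- h z) \<le> C * exp (K * r + \<delta> * r\<^sup>2)"
        unfolding eq using p(3) by simp
      then have "\<bar>Im (z $ k)\<bar> + exp (- h z) \<le> b"
        using Im_le[of z k] r(1) nv v(1) by simp
      then show ?thesis using b(2) by (metis ereal_less_eq(3) order_trans)
    qed
    ultimately show ?thesis by (simp add: ball_subset_tube_iff)
  qed
  moreover have "X \<in> cball X r \<inter> P"
    unfolding P_def V_def using r(2) vec.subspace_0[OF vec.subspace_span] by force
  ultimately have "ball X (exp (- h X)) \<subseteq> tube \<omega> a"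
    using q P r(2) unfolding q_pseudoconvex_iff[OF open_tube[OF \<open>open \<omega>\<close>]] by (metis open_UNIV subset_UNIV)
  then have "ball x (exp (- h X)) \<subseteq> \<omega>"
    by (simp add: ball_subset_tube_iff ReX)
  moreover have "exp (- h X) = C * exp (\<delta> * r\<^sup>2 / 2)"
  proof -
    have "- h X = ln C + \<delta> * r\<^sup>2 / 2"
      by (simp add: h_def b2_def linear_0[OF g] linear_0[OF linear_vec_Re] linear_0[OF linear_vec_Im])
    then show ?thesis using p(3) by (simp only: exp_add exp_ln)
  qed
  moreover have "C * 1 < C * exp (\<delta> * r\<^sup>2 / 2)"
    using p(3) pos r(2) by (intro mult_strict_left_mono) auto
  ultimately have "p \<in> \<omega>" using p(2) by (auto simp: subset_eq)
  then show False using p(1) by simp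
qed

text \<open>
  A finite tube only sees the boundary distance of \<omega> where it is smaller than the width of the tube.
  A touching point is therefore moved towards a nearest boundary point, together with the plane
  through it, which is sheared so that the points move by an affine multiple of the same vector.
  Because \<open>1 + s \<le> exp s\<close>, the lower bound for the boundary distance is only scaled.
\<close>

lemma slide_touching_towards_boundary:
  fixes x :: "'a::euclidean_space"
  assumes p: "p \<notin> \<omega>" "dist x p = C" "0 < C"
    and S: "subspace S" and g: "linear g" and pos: "\<delta> > 0" "\<rho> > 0"
    and touch: "\<And>w. w \<in> S \<Longrightarrow> norm w < \<rho> \<Longrightarrow>
      ball (x + w) (C * exp (g w + \<delta> * (norm w)\<^sup>2)) \<subseteq> \<omega>"
    and t: "0 < t" "t < 1"
  obtains x' S' g' \<delta>' \<rho>' where "dist x' p = (1 - t) * C" "subspace S'" "dim S' = dim S"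
    "linear g'" "\<delta>' > 0" "\<rho>' > 0"
    "\<And>w. w \<in> S' \<Longrightarrow> norm w < \<rho>' \<Longrightarrow>
      ball (x' + w) ((1 - t) * C * exp (g' w + \<delta>' * (norm w)\<^sup>2)) \<subseteq> \<omega>"
proof -
  define e where "e = p - x"
  have ne: "norm e = C" using p(2) by (simp add: e_def dist_norm norm_minus_commute)
  \<comment> \<open>Moving \<open>x + w\<close> by \<open>t * (1 + g w)\<close> times
    \<open>e\<close> leads to \<open>x + t *\<^sub>R e + T w\<close>, so \<open>T\<close> describes
    the directions of the moved plane.\<close>
  define T where "T w = w + (t * g w) *\<^sub>R e" for w
  have T: "linear T"
    unfolding T_def by (intro linearI) (simp_all add: linear_add[OF g] linear_scale[OF g] algebra_simps)
  \<comment> \<open>If the shear collapsed a direction, \<open>e\<close> would lie in S with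
    \<open>g e = - 1 / t\<close>. Stepping from \<open>x\<close> away from \<open>p\<close> would
    then enlarge the ball faster than the distance to \<open>p\<close>, and the ball would contain
    \<open>p\<close>.\<close>
  have inj: "w = 0" if w: "w \<in> S" "T w = 0" for w
  proof (rule ccontr)
    assume "w \<noteq> 0"
    have w': "w = - (t * g w) *\<^sub>R e" using w(2) by (simp add: T_def eq_neg_iff_add_eq_0)
    then have gw: "g w \<noteq> 0" using \<open>w \<noteq> 0\<close> by auto
    have "(- (1 / (t * g w))) *\<^sub>R w = (- (1 / (t * g w))) *\<^sub>R (- (t * g w) *\<^sub>R e)"
      using w' by (rule arg_cong)
    also have "\<dots> = e" using gw t(1) by simp
    finally have e': "e = (- (1 / (t * g w))) *\<^sub>R w" by (rule sym)
    then have "e \<in> S" using w(1) S subspace_scale by metis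
    have ge: "g e = - (1 / t)"
      unfolding e' linear_scale[OF g] using gw by simp
    define s where "s = \<rho> / (2 * C)"
    have s: "s > 0" "s * C < \<rho>" using pos p(3) by (auto simp: s_def)
    have se: "- s *\<^sub>R e \<in> S" using \<open>e \<in> S\<close> S subspace_scale by blast
    have "ball (x + - s *\<^sub>R e) (C * exp (g (- s *\<^sub>R e) + \<delta> * (norm (- s *\<^sub>R e))\<^sup>2)) \<subseteq> \<omega>"
      by (rule touch[OF se]) (use s in \<open>simp add: ne\<close>)
    moreover have "dist (x + - s *\<^sub>R e) p = (1 + s) * C"
    proof -
      have "x + - s *\<^sub>R e - p = - (1 + s) *\<^sub>R e" by (simp add: e_def algebra_simps)
      then show ?thesis using s(1) by (simp add: dist_norm ne del: scaleR_minus_left)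
    qed
    moreover have "(1 + s) * C < C * exp (g (- s *\<^sub>R e) + \<delta> * (norm (- s *\<^sub>R e))\<^sup>2)"
    proof -
      have "s < s / t" using s(1) t by (simp add: field_simps)
      then have "1 + s < 1 + g (- s *\<^sub>R e)" using ge by (simp add: linear_scale[OF g] linear_neg[OF g])
      also have "\<dots> \<le> exp (g (- s *\<^sub>R e))" by (rule exp_ge_add_one_self)
      also have "\<dots> \<le> exp (g (- s *\<^sub>R e) + \<delta> * (norm (- s *\<^sub>R e))\<^sup>2)" using pos by simp
      finally show ?thesis using p(3) by (simp add: mult.commute)
    qed
    ultimately show False using p(1) by (auto simp: subset_eq)
  qed
  obtain R M where R: "linear R" "\<And>w. w \<in> S \<Longrightarrow> R (T w) = w"
    and TS: "dim (T ` S) = dim S" "subspace (T ` S)"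
    using linear_left_inverse_on_bound[OF T S inj] by metis
  obtain N where N: "N > 0" "\<And>w. norm (T w) \<le> N * norm w"
    using linear_bounded_pos[OF T] by (metis mult.commute)
  obtain M where M: "M > 0" "\<And>w. norm (R w) \<le> M * norm w"
    using linear_bounded_pos[OF R(1)] by (metis mult.commute)
  obtain K where K: "K > 0" "\<And>w. norm (g w) \<le> K * norm w"
    using linear_bounded_pos[OF g] by (metis mult.commute)
  \<comment> \<open>The first bound keeps the preimage \<open>w\<close> within \<rho>; the second
    gives \<open>\<bar>g w\<bar> < 1\<close>, so that the factor \<open>1 + g w\<close> of the
    displacement is positive.\<close>
  define \<rho>' where "\<rho>' = min (\<rho> / M) (1 / (K * M))"
  show ?thesis
  proof
    have "x + t *\<^sub>R e - p = - ((1 - t) *\<^sub>R e)" by (simp add: e_def algebra_simps)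
    then show "dist (x + t *\<^sub>R e) p = (1 - t) * C" using t by (simp add: dist_norm ne)
    show "subspace (T ` S)" "dim (T ` S) = dim S" by fact+
    show "linear (g \<circ> R)" using R(1) g by (rule linear_compose)
    \<comment> \<open>The division compensates for the stretching of norms by \<open>T\<close>,
      which is at most \<open>N\<close>.\<close>
    show "\<delta> / N\<^sup>2 > 0" "\<rho>' > 0" using pos N M K by (auto simp: \<rho>'_def)
    fix w' assume w': "w' \<in> T ` S" "norm w' < \<rho>'"
    then obtain w where w: "w \<in> S" "w' = T w" by blast
    have Rw: "R w' = w" using w R(2) by simp
    have "norm w \<le> M * norm w'" using M(2)[of w'] Rw by simp
    moreover have "M * norm w' < \<rho>" "K * (M * norm w') < 1"
      using w'(2) M(1) K(1) by (auto simp: \<rho>'_def field_simps)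
    ultimately have nw: "norm w < \<rho>" "K * norm w < 1"
      using K(1) by (auto intro: le_less_trans[OF mult_left_mono])
    have gw: "\<bar>g w\<bar> < 1" using K(2)[of w] nw(2) by simp
    let ?E = "exp (g w + \<delta> * (norm w)\<^sup>2)"
    have "(1 - t) * C * exp ((g \<circ> R) w' + \<delta> / N\<^sup>2 * (norm w')\<^sup>2) \<le> (1 - t) * C * ?E"
    proof -
      have "(norm w')\<^sup>2 \<le> N\<^sup>2 * (norm w)\<^sup>2"
        using power_mono[OF N(2)[of w], of 2] w(2) by (simp add: power_mult_distrib)
      then have "\<delta> / N\<^sup>2 * (norm w')\<^sup>2 \<le> \<delta> * (norm w)\<^sup>2"
        using pos N(1) by (simp add: field_simps)
      then show ?thesis using t p(3) Rw by simp
    qed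
    moreover have "dist (x + w) (x + t *\<^sub>R e + w') \<le> t * C * ?E"
    proof -
      have "x + w - (x + t *\<^sub>R e + w') = - ((t * (1 + g w)) *\<^sub>R e)"
        by (simp add: w(2) T_def algebra_simps)
      then have "dist (x + w) (x + t *\<^sub>R e + w') = t * C * (1 + g w)"
        using t gw by (simp add: dist_norm ne abs_mult)
      also have "\<dots> \<le> t * C * ?E"
      proof (rule mult_left_mono)
        have "1 + g w \<le> exp (g w)" by (rule exp_ge_add_one_self)
        also have "\<dots> \<le> ?E" using pos by simp
        finally show "1 + g w \<le> ?E" .
      qed (use t p(3) in simp)
      finally show ?thesis .
    qed
    ultimately have "dist (x + w) (x + t *\<^sub>R e + w') +
        (1 - t) * C * exp ((g \<circ> R) w' + \<delta> / N\<^sup>2 * (norm w')\<^sup>2) \<le> C * ?E"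
      by (simp add: algebra_simps)
    then have "ball (x + t *\<^sub>R e + w') ((1 - t) * C * exp ((g \<circ> R) w' + \<delta> / N\<^sup>2 * (norm w')\<^sup>2))
        \<subseteq> ball (x + w) (C * ?E)"
      by (subst ball_subset_ball_iff) (auto simp: dist_commute)
    then show "ball (x + t *\<^sub>R e + w') ((1 - t) * C * exp ((g \<circ> R) w' + \<delta> / N\<^sup>2 * (norm w')\<^sup>2)) \<subseteq> \<omega>"
      using touch[OF w(1) nw(1)] by blast
  qed
qed

text \<open>A failure of real q-convexity gives a real touching point. It is slid towards a nearest
  boundary point \<open>p\<close> until its distance to \<open>p\<close> is below \<open>a\<close>,
  where \<open>q_pseudoconvex_tube_no_touching\<close> applies.\<close>

theorem real_q_convex_set_if_q_pseudoconvex_tube: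
  fixes \<omega> :: "(real^'n::finite) set"
  assumes "open \<omega>" "0 < a" and q: "q_pseudoconvex q (tube \<omega> a)"
  shows "real_q_convex_set q \<omega>"
  unfolding real_q_convex_set_iff[OF \<open>open \<omega>\<close>]
proof (intro allI impI ballI)
  fix P c r l y
  assume P: "affine P" "aff_dim P = int q + 1" and l: "affine_linear_on P l"
    and K: "cball c r \<subseteq> \<omega>" and bd: "\<forall>x\<in>sphere c r \<inter> P. ball x (exp (- l x)) \<subseteq> \<omega>"
    and y: "y \<in> cball c r \<inter> P"
  show "ball y (exp (- l y)) \<subseteq> \<omega>"
  proof (rule ccontr)
    assume contra: "\<not> ?thesis"
    then have fr: "frontier \<omega> \<noteq> {}"
      using y K by (auto simp: frontier_eq_empty)
    define m where "m x = - ln (infdist x (frontier \<omega>))" for x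
    have m_iff: "ball x (exp (- b)) \<subseteq> \<omega> \<longleftrightarrow> m x \<le> b" if "x \<in> cball c r \<inter> P" for x b
      unfolding m_def using ball_exp_subset_iff[OF \<open>open \<omega>\<close> _ fr] that K by blast
    have lt: "l y < m y" using contra m_iff[OF y] by simp
    have le: "m x \<le> l x" if "x \<in> sphere c r \<inter> P" for x
      using bd m_iff that by auto
    have "continuous_on (cball c r \<inter> P) m"
      unfolding m_def using continuous_on_neg_ln_infdist[OF \<open>open \<omega>\<close> fr] K
      by (auto elim: continuous_on_subset)
    note touching = real_touching_point[OF P(1) l this _ y lt]
    obtain x g \<delta> where x: "x \<in> ball c r \<inter> P" and g: "linear g" and \<delta>: "\<delta> > 0"
      and touch: "\<And>w. x + w \<in> cball c r \<inter> P \<Longrightarrow> m (x + w) \<le> m x + g w - \<delta> * (norm w)\<^sup>2"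
      by (rule touching[OF le], assumption) (rule that)
    have "x \<in> \<omega>" using x K by auto
    define C where "C = infdist x (frontier \<omega>)"
    have "C > 0" unfolding C_def by (rule infdist_frontier_pos[OF \<open>open \<omega>\<close> \<open>x \<in> \<omega>\<close> fr])
    obtain p where p: "p \<in> frontier \<omega>" "C = dist x p"
      unfolding C_def using infdist_attains_inf[OF frontier_closed fr] by blast
    have "p \<notin> \<omega>" using p(1) \<open>open \<omega>\<close> by (simp add: frontier_def interior_open)
    define S where "S = (\<lambda>z. z - x) ` P"
    have S: "subspace S"
      unfolding S_def using affine_diffs_subspace_subtract[OF P(1)] x by blast
    have "P = (+) x ` S" by (auto simp: S_def image_image)
    then have dimS: "dim S = q + 1"
      using P(2) aff_dim_subspace[OF S] by (simp add: aff_dim_translation_eq)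
    define \<rho> where "\<rho> = r - dist c x"
    have \<rho>: "\<rho> > 0" using x by (simp add: \<rho>_def)
    \<comment> \<open>Since \<open>m\<close> is minus the logarithm of the distance, an upper bound
      for \<open>m\<close> is a lower bound for the radius, with the signs of \<open>g\<close> and
      \<delta> reversed.\<close>
    have ball: "ball (x + w) (C * exp (- g w + \<delta> * (norm w)\<^sup>2)) \<subseteq> \<omega>"
      if w: "w \<in> S" "norm w < \<rho>" for w
    proof -
      have "dist c (x + w) \<le> dist c x + norm w"
        using dist_triangle[of c "x + w" x] by (simp add: dist_norm)
      then have inK: "x + w \<in> cball c r \<inter> P"
        using w by (auto simp: \<rho>_def \<open>P = (+) x ` S\<close>)
      have "ball (x + w) (exp (- (m x + g w - \<delta> * (norm w)\<^sup>2))) \<subseteq> \<omega>"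
        unfolding m_iff[OF inK] by (rule touch[OF inK])
      moreover have "exp (- (m x + g w - \<delta> * (norm w)\<^sup>2)) = C * exp (- g w + \<delta> * (norm w)\<^sup>2)"
      proof -
        have "- (m x + g w - \<delta> * (norm w)\<^sup>2) = ln C + (- g w + \<delta> * (norm w)\<^sup>2)"
          by (simp add: m_def C_def)
        then show ?thesis using \<open>C > 0\<close> by (simp only: exp_add exp_ln)
      qed
      ultimately show ?thesis by simp
    qed
    obtain t where t: "0 < t" "t < 1" "ereal ((1 - t) * C) < a"
    proof -
      obtain b where b: "0 < b" "ereal b < a"
        using ereal_dense2[of 0 a] \<open>0 < a\<close> by (auto simp: zero_ereal_def)
      \<comment> \<open>The bound \<open>b / C\<close> brings the remaining distance down to at most
        \<open>b\<close>, and \<open>1 / 2\<close> keeps \<open>t\<close> positive.\<close>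
      define t where "t = 1 - min (1 / 2) (b / C)"
      have "(1 - t) * C \<le> b / C * C" unfolding t_def using \<open>C > 0\<close> by (intro mult_right_mono) auto
      then have "(1 - t) * C \<le> b" using \<open>C > 0\<close> by simp
      then have "ereal ((1 - t) * C) < a"
        using b(2) by (metis ereal_less_eq(3) le_less_trans)
      moreover have "0 < t" "t < 1" using b(1) \<open>C > 0\<close> by (auto simp: t_def)
      ultimately show ?thesis using that by blast
    qed
    have ng: "linear (\<lambda>w. - g w)" using g by (rule linear_compose_neg)
    obtain x' S' g' \<delta>' \<rho>' where x': "dist x' p = (1 - t) * C" and S': "subspace S'" "dim S' = dim S"
      and g': "linear g'" "\<delta>' > 0" "\<rho>' > 0"
      and ball': "\<And>w. w \<in> S' \<Longrightarrow> norm w < \<rho>' \<Longrightarrow>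
        ball (x' + w) ((1 - t) * C * exp (g' w + \<delta>' * (norm w)\<^sup>2)) \<subseteq> \<omega>"
      by (rule slide_touching_towards_boundary[OF \<open>p \<notin> \<omega>\<close> p(2)[symmetric] \<open>C > 0\<close> S ng \<delta> \<rho> ball t(1,2)],
          assumption, assumption) (rule that)
    have "0 < (1 - t) * C" using t \<open>C > 0\<close> by simp
    then show False
      using q_pseudoconvex_tube_no_touching[OF q \<open>open \<omega>\<close> \<open>p \<notin> \<omega>\<close> x' _ t(3) S'(1) _ g' ball']
        S'(2) dimS by simp
  qed
qed

theorem mainTheorem2:
  fixes \<omega> :: "(real^'n::finite) set" and q :: nat
  assumes "q < CARD('n)" and "open \<omega>"
  shows "(real_q_convex_set q \<omega> \<longleftrightarrow> (\<exists>a::ereal. 0 < a \<and> q_pseudoconvex q (tube \<omega> a))) \<and>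
         ((\<exists>a::ereal. 0 < a \<and> q_pseudoconvex q (tube \<omega> a)) \<longleftrightarrow>
          (\<forall>a::ereal. 0 < a \<longrightarrow> q_pseudoconvex q (tube \<omega> a)))"
proof -
  \<comment> \<open>Passing from all widths to some width requires a positive one to exist.\<close>
  have "\<exists>a::ereal. 0 < a" by (rule exI[of _ 1]) simp
  then show ?thesis
    using q_pseudoconvex_tube_if_real_q_convex_set real_q_convex_set_if_q_pseudoconvex_tube
      \<open>open \<omega>\<close> by blast
qed

end
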